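(* Let $N,l\in\mathbb{N}$ with $l\le N$, let $\{P_i\}_{i=0}^l$ be probability measures on $\mathbb{R}$ with finite means $\mu_i$, and let $r_1,\dots,r_l\in\mathbb{R}$, satisfying Assumptions A and B stated in the context. Then for the delayed process $\{X^{N;D}_n\}_{n=0}^\infty$ the speed $$s^D(N,r_1,\dots,r_l):=\lim_{n\to\infty}\frac{X^{N;D}_n}{n}$$ exists almost surely and is almost surely constant.
   Context: Setting. $P_0,\dots,P_l$ (the increment distributions) are probability measures on $\mathbb{R}$ with finite means $\mu_i=\int x\,P_i(dx)$; $r_1,\dots,r_l$ are real numbers (thresholds). Set $r_0=-\infty$, $r_{l+1}=+\infty$. $N$ is the history window. Assumption A: $\mu_0<\mu_1<\dots<\mu_l$; $r_i<\mu_i<r_{i+1}$ for $i=1,\dots,l-1$; $\mu_0<r_1$; and $r_l<\mu_l$. Assumption B: $P_i((-\infty,r_i))>0$ and $P_i([r_{i+1},\infty))>0$ for $i=1,\dots,l-1$; $P_0([r_1,\infty))>0$; $P_l((-\infty,r_l))>0$. Delayed process $\{X^{N;D}_n\}_{n\ge0}$: $X^{N;D}_0=0$. At each time $n\ge0$ the process has a regime $J_n\in\{0,\dots,l\}$ and, conditionally on the past (positions and regimes up to time $n$), the increment $X^{N;D}_{n+1}-X^{N;D}_n$ has distribution $P_{J_n}$. For the first $N$ jumps, $J_0=\dots=J_{N-1}=i_*$ for some fixed starting regime $i_*\in\{0,\dots,l\}$. For $n\ge N$, let $i=J_{n-1}$. If $J_{n-N}\ne i$ then $J_n=i$. If $J_{n-N}=i$,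 let $A_n=\frac{X^{N;D}_n-X^{N;D}_{n-N}}{N}$ and put $J_n=i$ if $A_n\in[r_i,r_{i+1})$, $J_n=i-1$ if $A_n<r_i$, and $J_n=i+1$ if $A_n\ge r_{i+1}$. (Thus each regime is used at least $N$ consecutive times once entered.) *)

theory Defs
  imports "HOL-Probability.Probability"
begin

text \<open>
  The thresholds \<open>r 1, \<dots>, r l\<close>, extended by minus infinity at index \<open>0\<close> and by infinity
  at index \<open>l + 1\<close>; this is why they take values in \<^typ>\<open>ereal\<close>.
\<close>

definition threshold :: "nat \<Rightarrow> (nat \<Rightarrow> real) \<Rightarrow> nat \<Rightarrow> ereal" where
  "threshold l r i = (if i = 0 then -\<infinity> else if i \<le> l then ereal (r i) else \<infinity>)"

definition mean :: "real measure \<Rightarrow> real" where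
  "mean Q = (\<integral>x. x \<partial>Q)"

definition increment_distributions :: "nat \<Rightarrow> (nat \<Rightarrow> real measure) \<Rightarrow> bool" where
  "increment_distributions l P \<longleftrightarrow>
     (\<forall>i\<le>l. prob_space (P i) \<and> sets (P i) = sets borel \<and> integrable (P i) (\<lambda>x. x))"

definition assumption_A :: "nat \<Rightarrow> (nat \<Rightarrow> real measure) \<Rightarrow> (nat \<Rightarrow> real) \<Rightarrow> bool" where
  "assumption_A l P r \<longleftrightarrow>
     (\<forall>i<l. mean (P i) < mean (P (Suc i))) \<and>
     (\<forall>i\<in>{1..l - 1}. threshold l r i < mean (P i) \<and> mean (P i) < threshold l r (Suc i)) \<and>
     mean (P 0) < threshold l r 1 \<and>
     threshold l r l < mean (P l)"

text \<open>
  For \<open>l = 0\<close> the last two conditions read \<open>measure (P 0) {} > 0\<close> and are false, so that this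
  assumption forces \<open>l \<ge> 1\<close>.
\<close>

definition assumption_B :: "nat \<Rightarrow> (nat \<Rightarrow> real measure) \<Rightarrow> (nat \<Rightarrow> real) \<Rightarrow> bool" where
  "assumption_B l P r \<longleftrightarrow>
     (\<forall>i\<in>{1..l - 1}. measure (P i) {x. ereal x < threshold l r i} > 0 \<and>
                      measure (P i) {x. threshold l r (Suc i) \<le> ereal x} > 0) \<and>
     measure (P 0) {x. threshold l r 1 \<le> ereal x} > 0 \<and>
     measure (P l) {x. ereal x < threshold l r l} > 0"

text \<open>
  The sigma-algebra generated by the positions \<open>X 0, \<dots>, X n\<close> and the regimes
  \<open>J 0, \<dots>, J n\<close>.
\<close>

definition past ::
  "'a measure \<Rightarrow> (nat \<Rightarrow> 'a \<Rightarrow> real) \<Rightarrow> (nat \<Rightarrow> 'a \<Rightarrow> nat) \<Rightarrow> nat \<Rightarrow> 'a measure" where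
  "past M X J n =
     vimage_algebra (space M) (\<lambda>\<omega>. \<lambda>k\<in>{..n}. (X k \<omega>, J k \<omega>))
       (\<Pi>\<^sub>M k\<in>{..n}. borel \<Otimes>\<^sub>M count_space UNIV)"

text \<open>
  The regime following \<open>i\<close> if the last \<open>N\<close> jumps were all made in regime \<open>i\<close> and have
  average \<open>a\<close>. Since the outer thresholds are infinite, \<open>i - 1\<close> is never taken for \<open>i = 0\<close>
  and \<open>i + 1\<close> is never taken for \<open>i = l\<close>.
\<close>

definition next_regime :: "nat \<Rightarrow> (nat \<Rightarrow> real) \<Rightarrow> nat \<Rightarrow> real \<Rightarrow> nat" where
  "next_regime l r i a =
     (if ereal a < threshold l r i then i - 1
      else if threshold l r (Suc i) \<le> ereal a then i + 1
      else i)"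

text \<open>
  The conditional law of the increment is expressed by conditional probabilities of events,
  that is, by conditional expectations of indicator functions.
\<close>

locale delayed_process = prob_space M
  for M :: "'a measure" +
  fixes N l :: nat
    and P :: "nat \<Rightarrow> real measure"
    and r :: "nat \<Rightarrow> real"
    and start :: nat
    and X :: "nat \<Rightarrow> 'a \<Rightarrow> real"
    and J :: "nat \<Rightarrow> 'a \<Rightarrow> nat"
  assumes start_le: "start \<le> l"
    and X_measurable: "\<And>n. X n \<in> borel_measurable M"
    and J_measurable: "\<And>n. J n \<in> measurable M (count_space UNIV)"
    and X_0: "\<And>\<omega>. \<omega> \<in> space M \<Longrightarrow> X 0 \<omega> = 0"
    and increment: "\<And>n B. B \<in> sets borel \<Longrightarrow>
      AE \<omega> in M. real_cond_exp M (past M X J n)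
        (\<lambda>\<omega>'. indicator B (X (Suc n) \<omega>' - X n \<omega>')) \<omega> = measure (P (J n \<omega>)) B"
    and J_start: "\<And>n \<omega>. \<omega> \<in> space M \<Longrightarrow> n < N \<Longrightarrow> J n \<omega> = start"
    and J_step: "\<And>n \<omega>. \<omega> \<in> space M \<Longrightarrow> N \<le> n \<Longrightarrow>
      J n \<omega> = (if J (n - N) \<omega> \<noteq> J (n - 1) \<omega> then J (n - 1) \<omega>
               else next_regime l r (J (n - 1) \<omega>) ((X n \<omega> - X (n - N) \<omega>) / real N))"

end

theory Submission
  imports Defs
begin

text \<open>
  Fix a regime \<open>i\<close>. Upon each entry to \<open>i\<close> the process starts afresh, so the expected
  duration \<open>m i\<close> of a stay and the probabilities \<open>u i\<close>, \<open>d i\<close> of leaving it upwards or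
  downwards are constants. A martingale strong law shows that, up to \<open>o(n)\<close>, the time spent
  in \<open>i\<close> and the numbers of up- and down-crossings from \<open>i\<close> before time \<open>n\<close> are \<open>m i\<close>,
  \<open>u i\<close> and \<open>d i\<close> times the number of entries to \<open>i\<close>. Regimes change by one step at a time,
  hence the crossings from \<open>i\<close> to \<open>i + 1\<close> and back differ in number by at most one. These
  balance equations determine the limiting fraction of time spent in each regime, and the
  strong law for the increments made in each regime yields the speed.
\<close>

section \<open>A strong law for orthogonal random variables\<close>

text \<open>The process is given through conditional laws of single increments, while entries occur
  at random times, so independent cycles for a renewal argument are not at hand. Everything is
  therefore phrased at deterministic times: a term attached to jump \<open>k\<close> carries the
  indicator of \<open>J k = i\<close>, and averages are taken over the total time \<open>n\<close>,
  which stays meaningful for regimes that are rarely used. The constants arise because the expected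
  remaining reward is constructed as a function of the age of the stay and of the increments seen
  during it; at age 0 nothing is left to depend on.

  Two obstacles shape the strong law: the centred terms are orthogonal but in general not
  independent, and increments have only a first moment. A subsequence argument needs orthogonality,
  a one-sided bound and summable weighted second moments, and truncated nonnegative variables have
  all three. Assumption B bounds the expected stay and makes crossing probabilities positive:
  \<open>N\<close> consecutive increments beyond a threshold carry the window average across
  it.\<close>

lemma sum_inverse_powers_above_le:
  fixes b q :: real
  assumes "b > 1" "q > 0"
  shows "(\<Sum>n | n < m \<and> q \<le> b ^ n. 1 / b ^ n) \<le> 1 / (q * (1 - 1 / b))"
proof (cases "{n. n < m \<and> q \<le> b ^ n} = {}")
  case True
  then show ?thesis using assms by (simp add: True)
next
  case False
  then obtain n1 where n1: "q \<le> b ^ n1" by auto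
  define n0 where "n0 = (LEAST n. q \<le> b ^ n)"
  have n0: "q \<le> b ^ n0" unfolding n0_def using n1 by (rule LeastI)
  have le: "n0 \<le> n" if "q \<le> b ^ n" for n unfolding n0_def using that by (rule Least_le)
  have b: "b > 0" using assms by simp
  have "(\<Sum>n | n < m \<and> q \<le> b ^ n. 1 / b ^ n) \<le> (\<Sum>n\<in>{0 + n0..<m + n0}. 1 / b ^ n)"
    using le b by (intro sum_mono2) auto
  also have "\<dots> = (\<Sum>n\<in>{0..<m}. 1 / b ^ n0 * (1 / b) ^ n)"
    by (subst sum.shift_bounds_nat_ivl) (simp add: power_add field_simps)
  also have "\<dots> = 1 / b ^ n0 * (\<Sum>n<m. (1 / b) ^ n)"
    by (simp add: sum_distrib_left lessThan_atLeast0)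
  also have "(\<Sum>n<m. (1 / b) ^ n) \<le> (\<Sum>n. (1 / b) ^ n)"
    using assms b by (intro sum_le_suminf summable_geometric) auto
  also have "(\<Sum>n. (1 / b) ^ n) = 1 / (1 - 1 / b)"
    using assms b by (intro suminf_geometric) auto
  also have "1 / b ^ n0 * (1 / (1 - 1 / b)) \<le> 1 / q * (1 / (1 - 1 / b))"
    using assms b n0 by (intro mult_right_mono frac_le) auto
  finally show ?thesis using b by (simp add: divide_simps)
qed

text \<open>After interchanging the sums, \<open>v j\<close> is weighted by the inverse squares of
  all block lengths \<open>k n > j\<close>. These lengths grow geometrically, so the weight is of
  the order of \<open>1 / (real (Suc j))\<^sup>2\<close>.\<close>

lemma summable_geometric_blocks:
  fixes a :: real and v :: "nat \<Rightarrow> real"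
  assumes a: "a > 1" and v: "\<And>j. v j \<ge> 0" and sm: "summable (\<lambda>j. v j / (real (Suc j))\<^sup>2)"
  defines "k \<equiv> \<lambda>n. nat \<lfloor>a ^ n\<rfloor>"
  shows "summable (\<lambda>n. (\<Sum>j<k n. v j) / (real (k n))\<^sup>2)"
proof (rule summableI_nonneg_bounded)
  fix m
  have kle: "real (k n) \<le> a ^ n" for n
    using a unfolding k_def by (simp add: of_nat_floor)
  \<comment> \<open>Rounding down at most halves a power that is at least 1; squaring this loss
    gives the 4 in \<open>c\<close>.\<close>
  have kge: "a ^ n / 2 \<le> real (k n)" and k1: "1 \<le> k n" for n
  proof -
    have "1 \<le> a ^ n" using a by simp
    moreover have "a ^ n - 1 < real (k n)" and "1 \<le> \<lfloor>a ^ n\<rfloor>"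
      using a unfolding k_def by (linarith, simp)
    ultimately show "a ^ n / 2 \<le> real (k n)" "1 \<le> k n" unfolding k_def by linarith+
  qed
  define K where "K = Max (k ` {..<Suc m})"
  have K: "k n \<le> K" if "n < m" for n
    unfolding K_def using that by (intro Max_ge) auto
  define c where "c = 4 / (1 - 1 / a\<^sup>2)"
  have a2: "a\<^sup>2 > 1" using a by (simp add: one_less_power)
  have c: "c \<ge> 0" using a2 by (simp add: c_def divide_le_eq)
  have inner: "(\<Sum>n | n < m \<and> j < k n. 1 / (real (k n))\<^sup>2) \<le> c / (real (Suc j))\<^sup>2" for j
  proof -
    have "(\<Sum>n | n < m \<and> j < k n. 1 / (real (k n))\<^sup>2) \<le> (\<Sum>n | n < m \<and> j < k n. 4 * (1 / (a\<^sup>2) ^ n))"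
    proof (rule sum_mono)
      fix n
      have "(a ^ n / 2)\<^sup>2 \<le> (real (k n))\<^sup>2" using kge a by (intro power_mono) auto
      then have "1 / (real (k n))\<^sup>2 \<le> 1 / (a ^ n / 2)\<^sup>2"
        using a k1[of n] by (intro frac_le) auto
      also have "\<dots> = 4 * (1 / (a\<^sup>2) ^ n)"
        by (simp add: power_divide power_mult[symmetric] mult.commute)
      finally show "1 / (real (k n))\<^sup>2 \<le> 4 * (1 / (a\<^sup>2) ^ n)" .
    qed
    also have "\<dots> \<le> (\<Sum>n | n < m \<and> (real (Suc j))\<^sup>2 \<le> (a\<^sup>2) ^ n. 4 * (1 / (a\<^sup>2) ^ n))"
    proof (rule sum_mono2)
      show "{n. n < m \<and> j < k n} \<subseteq> {n. n < m \<and> (real (Suc j))\<^sup>2 \<le> (a\<^sup>2) ^ n}"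
      proof safe
        fix n assume "j < k n"
        then have "real (Suc j) \<le> a ^ n" using kle[of n] by linarith
        then have "(real (Suc j))\<^sup>2 \<le> (a ^ n)\<^sup>2" by (intro power_mono) auto
        then show "(real (Suc j))\<^sup>2 \<le> (a\<^sup>2) ^ n" by (simp add: power_mult[symmetric] mult.commute)
      qed
    qed auto
    also have "\<dots> \<le> 4 * (1 / ((real (Suc j))\<^sup>2 * (1 - 1 / a\<^sup>2)))"
      unfolding sum_distrib_left[symmetric]
      using a2 by (intro mult_left_mono sum_inverse_powers_above_le) auto
    finally show ?thesis by (simp add: c_def mult.commute)
  qed
  have "(\<Sum>n<m. (\<Sum>j<k n. v j) / (real (k n))\<^sup>2)
      = (\<Sum>n<m. \<Sum>j<K. if j < k n then v j / (real (k n))\<^sup>2 else 0)"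
  proof (rule sum.cong[OF refl])
    fix n assume "n \<in> {..<m}"
    then have "{j. j < K \<and> j < k n} = {..<k n}" using K[of n] by auto
    moreover have "(\<Sum>j<K. if j < k n then v j / (real (k n))\<^sup>2 else 0) = (\<Sum>j | j < K \<and> j < k n. v j / (real (k n))\<^sup>2)"
      by (subst sum.inter_filter[symmetric]) auto
    ultimately show "(\<Sum>j<k n. v j) / (real (k n))\<^sup>2 = (\<Sum>j<K. if j < k n then v j / (real (k n))\<^sup>2 else 0)"
      by (simp add: sum_divide_distrib)
  qed
  also have "\<dots> = (\<Sum>j<K. \<Sum>n<m. if j < k n then v j / (real (k n))\<^sup>2 else 0)"
    by (rule sum.swap)
  also have "\<dots> = (\<Sum>j<K. v j * (\<Sum>n | n < m \<and> j < k n. 1 / (real (k n))\<^sup>2))"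
  proof (rule sum.cong[OF refl])
    fix j
    have "(\<Sum>n<m. if j < k n then v j / (real (k n))\<^sup>2 else 0) = (\<Sum>n | n < m \<and> j < k n. v j / (real (k n))\<^sup>2)"
      by (subst sum.inter_filter[symmetric]) auto
    then show "(\<Sum>n<m. if j < k n then v j / (real (k n))\<^sup>2 else 0) = v j * (\<Sum>n | n < m \<and> j < k n. 1 / (real (k n))\<^sup>2)"
      by (simp add: sum_distrib_left)
  qed
  also have "\<dots> \<le> (\<Sum>j<K. v j * (c / (real (Suc j))\<^sup>2))"
    using inner v by (intro sum_mono mult_left_mono) auto
  also have "\<dots> = c * (\<Sum>j<K. v j / (real (Suc j))\<^sup>2)"
    by (simp add: sum_distrib_left mult.commute)
  also have "\<dots> \<le> c * (\<Sum>j. v j / (real (Suc j))\<^sup>2)"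
    using c v sm by (intro mult_left_mono sum_le_suminf) auto
  finally show "(\<Sum>n<m. (\<Sum>j<k n. v j) / (real (k n))\<^sup>2) \<le> c * (\<Sum>j. v j / (real (Suc j))\<^sup>2)" .
next
  fix n show "0 \<le> (\<Sum>j<k n. v j) / (real (k n))\<^sup>2" using v by (simp add: sum_nonneg)
qed

text \<open>Between consecutive members of a subsequence of ratio \<open>a\<close>, monotonicity
  traps \<open>T n / real n\<close> up to a factor close to \<open>a\<close>, and \<open>a\<close>
  may be taken close to 1. The ratios form a countable family, so almost sure convergence can be had
  along all of them at once.\<close>

lemma LIMSEQ_ratio_of_geometric_subseqs:
  fixes T :: "nat \<Rightarrow> real"
  assumes mono: "mono T" and T0: "T 0 \<ge> 0"
    and lim: "\<And>q. (\<lambda>n. T (nat \<lfloor>(1 + 1 / real (Suc q)) ^ n\<rfloor>) / real (nat \<lfloor>(1 + 1 / real (Suc q)) ^ n\<rfloor>)) \<longlonglongrightarrow> c"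
  shows "(\<lambda>n. T n / real n) \<longlonglongrightarrow> c"
proof (rule LIMSEQ_I)
  fix e :: real assume e: "e > 0"
  have Tnn: "T n \<ge> 0" for n using T0 monoD[OF mono, of 0 n] by simp
  have c: "c \<ge> 0" by (rule LIMSEQ_le_const[OF lim[of 0]]) (auto simp: Tnn)
  define d where "d = (\<lambda>q. 1 / real (Suc q))"
  have d0: "d \<longlonglongrightarrow> 0" unfolding d_def by (rule lim_1_over_n[THEN LIMSEQ_Suc])
  \<comment> \<open>The products are the two bounds of the sandwich below for the ratio
    \<open>1 + d q\<close>. The \<open>d q\<close> subtracted in the lower factor absorbs the
    rounding in \<open>k\<close>; the third limit keeps that factor positive.\<close>
  have "(\<lambda>q. (1 + d q) * (c + d q)) \<longlonglongrightarrow> (1 + 0) * (c + 0)"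
    by (intro tendsto_intros d0)
  moreover have "(\<lambda>q. (1 / (1 + d q) - d q) * (c - d q)) \<longlonglongrightarrow> (1 / (1 + 0) - 0) * (c - 0)"
    by (intro tendsto_intros d0) auto
  moreover have "(\<lambda>q. 1 / (1 + d q) - d q) \<longlonglongrightarrow> 1 / (1 + 0) - 0"
    by (intro tendsto_intros d0) auto
  ultimately have "\<forall>\<^sub>F q in sequentially. (1 + d q) * (c + d q) < c + e \<and>
      (1 / (1 + d q) - d q) * (c - d q) > c - e \<and> 1 / (1 + d q) - d q > 0"
    using e order_tendstoD(1)[of "\<lambda>q. 1 / (1 + d q) - d q" "1 / (1 + 0) - 0" sequentially 0]
    by (intro eventually_conj) (auto elim: order_tendstoD)
  then obtain q where q: "(1 + d q) * (c + d q) < c + e"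
      "(1 / (1 + d q) - d q) * (c - d q) > c - e" "1 / (1 + d q) - d q > 0"
    by (auto dest: eventually_happens)
  define a where "a = 1 + d q"
  have dq: "d q > 0" by (simp add: d_def)
  have a: "a > 1" using dq by (simp add: a_def)
  define k where "k = (\<lambda>n. nat \<lfloor>a ^ n\<rfloor>)"
  have limk: "(\<lambda>n. T (k n) / real (k n)) \<longlonglongrightarrow> c"
    using lim[of q] unfolding k_def a_def d_def .
  have inv0: "(\<lambda>n. 1 / a ^ n) \<longlonglongrightarrow> 0"
    using LIMSEQ_inverse_realpow_zero[OF a] by (simp add: field_simps)
  have "\<forall>\<^sub>F p in sequentially. c - d q < T (k p) / real (k p) \<and> T (k p) / real (k p) < c + d q \<and> 1 / a ^ p < d q"
    using dq order_tendstoD[OF limk] order_tendstoD[OF inv0] by (intro eventually_conj) auto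
  then obtain p0 where p0: "\<And>p. p \<ge> p0 \<Longrightarrow> c - d q < T (k p) / real (k p) \<and> T (k p) / real (k p) < c + d q \<and> 1 / a ^ p < d q"
    by (auto simp: eventually_sequentially)
  have kle: "real (k n) \<le> a ^ n" for n
    using a unfolding k_def by (simp add: of_nat_floor)
  have kge: "a ^ n - 1 < real (k n)" and k1: "1 \<le> k n" for n
  proof -
    show "a ^ n - 1 < real (k n)" unfolding k_def by linarith
    have "1 \<le> \<lfloor>a ^ n\<rfloor>" using a by simp
    then show "1 \<le> k n" unfolding k_def by linarith
  qed
  show "\<exists>n0. \<forall>n\<ge>n0. norm (T n / real n - c) < e"
  proof (intro exI allI impI)
    fix n assume n: "n \<ge> nat \<lceil>a ^ p0\<rceil>"
    then have nge: "a ^ p0 \<le> real n" by linarith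
    have "1 \<le> a ^ p0" using a by simp
    with nge have npos: "real n > 0" by linarith
    obtain p1 where p1: "real n < a ^ p1" using real_arch_pow[OF a] by blast
    define p' where "p' = (LEAST p. real n < a ^ p)"
    have p': "real n < a ^ p'" unfolding p'_def using p1 by (rule LeastI)
    have "p' > p0"
    proof (rule ccontr)
      assume "\<not> p0 < p'"
      then have "a ^ p' \<le> a ^ p0" using a by (intro power_increasing) auto
      then show False using p' nge by linarith
    qed
    then obtain p where p: "p' = Suc p" "p \<ge> p0" by (cases p') auto
    have pn: "a ^ p \<le> real n" using not_less_Least[of p "\<lambda>p. real n < a ^ p"] p by (auto simp: p'_def)
    have kn: "k p \<le> n" using kle[of p] pn by linarith
    have nk: "n \<le> k (Suc p)" using p' p unfolding k_def by (simp add: le_nat_iff le_floor_iff)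
    have "T n / real n \<le> T (k (Suc p)) / real n"
      using monoD[OF mono nk] npos by (intro divide_right_mono) auto
    also have "\<dots> = T (k (Suc p)) / real (k (Suc p)) * (real (k (Suc p)) / real n)"
      using k1[of "Suc p"] by simp
    also have "\<dots> \<le> (c + d q) * (real (k (Suc p)) / real n)"
      using p0[of "Suc p"] p by (intro mult_right_mono) auto
    also have "\<dots> \<le> (c + d q) * a"
    proof (intro mult_left_mono)
      have "real (k (Suc p)) \<le> a * a ^ p" using kle[of "Suc p"] by simp
      also have "\<dots> \<le> a * real n" using pn a by simp
      finally show "real (k (Suc p)) / real n \<le> a" using npos by (simp add: divide_le_eq)
    qed (use c dq in auto)
    finally have up: "T n / real n < c + e" using q(1) by (simp add: a_def mult.commute)
    have rat: "1 / a - d q \<le> real (k p) / real n"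
    proof -
      have "1 / a - d q \<le> 1 / a - 1 / a ^ Suc p" using p0[of "Suc p"] p by simp
      also have "\<dots> = (a ^ p - 1) / a ^ Suc p" using a by (simp add: field_simps)
      also have "\<dots> \<le> (a ^ p - 1) / real n"
        using p' p npos a by (intro divide_left_mono) auto
      also have "\<dots> \<le> real (k p) / real n"
        using kge[of p] by (intro divide_right_mono) auto
      finally show ?thesis .
    qed
    have "(1 / a - d q) * (c - d q) \<le> T n / real n"
    \<comment> \<open>The product of the lower bounds is legitimate for nonnegative factors;
      otherwise nonnegativity of \<open>T\<close> suffices.\<close>
    proof (cases "c - d q \<le> 0")
      case True
      then have "(1 / a - d q) * (c - d q) \<le> 0" using q(3) by (simp add: a_def mult_nonneg_nonpos)
      also have "0 \<le> T n / real n" by (simp add: Tnn)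
      finally show ?thesis .
    next
      case False
      have "(1 / a - d q) * (c - d q) \<le> real (k p) / real n * (T (k p) / real (k p))"
        using False rat q(3) p0[of p] p by (intro mult_mono) (auto simp: a_def)
      also have "\<dots> = T (k p) / real n" using k1[of p] by simp
      also have "\<dots> \<le> T n / real n" using monoD[OF mono kn] by (intro divide_right_mono) auto
      finally show ?thesis .
    qed
    then have "c - e < T n / real n" using q(2) by (simp add: a_def)
    with up show "norm (T n / real n - c) < e" by (simp add: abs_less_iff)
  qed
qed

text \<open>The series has finite expectation, hence converges almost surely. Applied to squares
  this replaces Chebyshev's inequality with Borel-Cantelli; applied to indicators it says that
  almost surely finitely many events occur.\<close>

lemma AE_LIMSEQ_0_of_summable_integral:
  fixes f :: "nat \<Rightarrow> 'a \<Rightarrow> real"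
  assumes f: "\<And>n. integrable M (f n)" "\<And>n x. 0 \<le> f n x"
    and sm: "summable (\<lambda>n. \<integral>x. f n x \<partial>M)"
  shows "AE x in M. (\<lambda>n. f n x) \<longlonglongrightarrow> 0"
proof -
  have [measurable]: "f n \<in> borel_measurable M" for n using f(1) by (rule borel_measurable_integrable)
  have "(\<integral>\<^sup>+x. (\<Sum>n. ennreal (f n x)) \<partial>M) = (\<Sum>n. \<integral>\<^sup>+x. ennreal (f n x) \<partial>M)"
    by (rule nn_integral_suminf) measurable
  also have "\<dots> = (\<Sum>n. ennreal (\<integral>x. f n x \<partial>M))"
    using f by (subst nn_integral_eq_integral) auto
  also have "\<dots> = ennreal (\<Sum>n. \<integral>x. f n x \<partial>M)"
    using f sm by (intro suminf_ennreal2) auto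
  finally have "(\<integral>\<^sup>+x. (\<Sum>n. ennreal (f n x)) \<partial>M) \<noteq> \<infinity>" by simp
  then have "AE x in M. (\<Sum>n. ennreal (f n x)) \<noteq> \<infinity>"
    by (rule nn_integral_PInf_AE[rotated]) measurable
  then show ?thesis
  proof eventually_elim
    case (elim x)
    then have "summable (\<lambda>n. f n x)" using f by (intro summable_suminf_not_top) auto
    then show ?case by (rule summable_LIMSEQ_zero)
  qed
qed

lemma integrable_mult_of_squares:
  fixes f g :: "'a \<Rightarrow> real"
  assumes [measurable]: "f \<in> borel_measurable M" "g \<in> borel_measurable M"
    and "integrable M (\<lambda>x. (f x)\<^sup>2)" "integrable M (\<lambda>x. (g x)\<^sup>2)"
  shows "integrable M (\<lambda>x. f x * g x)"
proof (rule Bochner_Integration.integrable_bound)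
  show "integrable M (\<lambda>x. (f x)\<^sup>2 + (g x)\<^sup>2)" using assms by simp
  have "\<bar>a * b\<bar> \<le> a\<^sup>2 + b\<^sup>2" for a b :: real
  proof -
    have "0 \<le> (\<bar>a\<bar> - \<bar>b\<bar>)\<^sup>2" by simp
    then have "2 * \<bar>a * b\<bar> \<le> a\<^sup>2 + b\<^sup>2" by (simp add: power2_diff abs_mult)
    then show ?thesis by simp
  qed
  then show "AE x in M. norm (f x * g x) \<le> norm ((f x)\<^sup>2 + (g x)\<^sup>2)" by simp
qed measurable

lemma integral_square_sum_orthogonal:
  fixes D :: "nat \<Rightarrow> 'a \<Rightarrow> real"
  assumes [measurable]: "\<And>n. D n \<in> borel_measurable M"
    and sq: "\<And>n. integrable M (\<lambda>x. (D n x)\<^sup>2)"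
    and orth: "\<And>i j. i < j \<Longrightarrow> (\<integral>x. D i x * D j x \<partial>M) = 0"
  shows "integrable M (\<lambda>x. (\<Sum>k<n. D k x)\<^sup>2)"
    and "(\<integral>x. (\<Sum>k<n. D k x)\<^sup>2 \<partial>M) = (\<Sum>k<n. \<integral>x. (D k x)\<^sup>2 \<partial>M)"
proof -
  have int: "integrable M (\<lambda>x. D i x * D j x)" for i j
    by (intro integrable_mult_of_squares sq) measurable
  have "integrable M (\<lambda>x. (\<Sum>k<n. D k x)\<^sup>2) \<and>
    (\<integral>x. (\<Sum>k<n. D k x)\<^sup>2 \<partial>M) = (\<Sum>k<n. \<integral>x. (D k x)\<^sup>2 \<partial>M)"
  proof (induction n)
    case (Suc n)
    have eq: "(\<Sum>k<Suc n. D k x)\<^sup>2 = (\<Sum>k<n. D k x)\<^sup>2 + (D n x)\<^sup>2 + 2 * (\<Sum>k<n. D k x * D n x)" for x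
      by (simp add: power2_sum sum_distrib_right)
    have i: "integrable M (\<lambda>x. 2 * (\<Sum>k<n. D k x * D n x))" using int by auto
    have "(\<integral>x. 2 * (\<Sum>k<n. D k x * D n x) \<partial>M) = 0"
      using int orth by (simp add: Bochner_Integration.integral_sum)
    then show ?case unfolding eq using Suc sq i by simp
  qed simp
  then show "integrable M (\<lambda>x. (\<Sum>k<n. D k x)\<^sup>2)"
    "(\<integral>x. (\<Sum>k<n. D k x)\<^sup>2 \<partial>M) = (\<Sum>k<n. \<integral>x. (D k x)\<^sup>2 \<partial>M)" by auto
qed

text \<open>Etemadi's method: convergence along geometric subsequences, where Chebyshev's bounds are
  summable, suffices because the lower bound on \<open>D\<close> makes the sums plus \<open>C n\<close> monotone.\<close>

lemma strong_law_orthogonal: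
  fixes D :: "nat \<Rightarrow> 'a \<Rightarrow> real"
  assumes meas: "\<And>n. D n \<in> borel_measurable M"
    and sq: "\<And>n. integrable M (\<lambda>x. (D n x)\<^sup>2)"
    and orth: "\<And>i j. i < j \<Longrightarrow> (\<integral>x. D i x * D j x \<partial>M) = 0"
    and lower: "\<And>n x. x \<in> space M \<Longrightarrow> - C \<le> D n x"
    and sm: "summable (\<lambda>n. (\<integral>x. (D n x)\<^sup>2 \<partial>M) / (real (Suc n))\<^sup>2)"
  shows "AE x in M. (\<lambda>n. (\<Sum>k<n. D k x) / real n) \<longlonglongrightarrow> 0"
proof -
  define k where "k = (\<lambda>q n. nat \<lfloor>(1 + 1 / real (Suc q)) ^ n\<rfloor>)"
  have "AE x in M. (\<lambda>n. (\<Sum>j<k q n. D j x)\<^sup>2 / (real (k q n))\<^sup>2) \<longlonglongrightarrow> 0" for q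
  proof (rule AE_LIMSEQ_0_of_summable_integral)
    show "integrable M (\<lambda>x. (\<Sum>j<k q n. D j x)\<^sup>2 / (real (k q n))\<^sup>2)" for n
      using integral_square_sum_orthogonal(1)[OF meas sq orth] by simp
    \<comment> \<open>Orthogonality turns the second moment of a block sum into a sum of second
      moments, to which the block estimate applies.\<close>
    show "summable (\<lambda>n. \<integral>x. (\<Sum>j<k q n. D j x)\<^sup>2 / (real (k q n))\<^sup>2 \<partial>M)"
      using summable_geometric_blocks[of "1 + 1 / real (Suc q)" "\<lambda>n. \<integral>x. (D n x)\<^sup>2 \<partial>M"] sm
        integral_square_sum_orthogonal(2)[OF meas sq orth]
      by (simp add: k_def)
  qed simp
  then have "AE x in M. \<forall>q. (\<lambda>n. (\<Sum>j<k q n. D j x)\<^sup>2 / (real (k q n))\<^sup>2) \<longlonglongrightarrow> 0"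
    by (simp add: AE_all_countable)
  then show ?thesis
    using AE_space
  proof eventually_elim
    case (elim x)
    define T where "T = (\<lambda>n. (\<Sum>j<n. D j x) + C * real n)"
    have "incseq T"
    proof (rule incseq_SucI)
      fix n show "T n \<le> T (Suc n)" using lower[OF elim(2), of n] by (simp add: T_def algebra_simps)
    qed
    moreover have "(\<lambda>n. T (k q n) / real (k q n)) \<longlonglongrightarrow> C" for q
    proof -
      have "(\<lambda>n. sqrt ((\<Sum>j<k q n. D j x)\<^sup>2 / (real (k q n))\<^sup>2)) \<longlonglongrightarrow> sqrt 0"
        using elim(1) by (intro tendsto_real_sqrt) simp
      then have "(\<lambda>n. \<bar>(\<Sum>j<k q n. D j x) / real (k q n)\<bar>) \<longlonglongrightarrow> 0"
        by (simp add: real_sqrt_divide)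
      then have "(\<lambda>n. (\<Sum>j<k q n. D j x) / real (k q n)) \<longlonglongrightarrow> 0"
        unfolding tendsto_rabs_zero_iff .
      then have "(\<lambda>n. (\<Sum>j<k q n. D j x) / real (k q n) + C) \<longlonglongrightarrow> 0 + C"
        by (intro tendsto_intros)
      moreover have "(\<Sum>j<k q n. D j x) / real (k q n) + C = T (k q n) / real (k q n)" for n
      proof -
        have "1 \<le> (1 + 1 / real (Suc q)) ^ n" by (rule one_le_power) simp
        then have "1 \<le> \<lfloor>(1 + 1 / real (Suc q)) ^ n\<rfloor>" by (simp only: one_le_floor)
        then have "1 \<le> k q n" unfolding k_def by linarith
        then show ?thesis by (simp add: T_def field_simps)
      qed
      ultimately show ?thesis by simp
    qed
    ultimately have "(\<lambda>n. T n / real n) \<longlonglongrightarrow> C"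
      by (intro LIMSEQ_ratio_of_geometric_subseqs) (auto simp: T_def k_def)
    then have "(\<lambda>n. T n / real n - C) \<longlonglongrightarrow> C - C" by (intro tendsto_intros)
    moreover have "\<forall>\<^sub>F n in sequentially. T n / real n - C = (\<Sum>j<n. D j x) / real n"
      using eventually_gt_at_top[of 0] by eventually_elim (simp add: T_def field_simps)
    ultimately show ?case by (simp add: tendsto_cong)
  qed
qed

section \<open>Cesaro means and truncation estimates\<close>

lemma LIMSEQ_arith_mean_0:
  fixes a :: "nat \<Rightarrow> real"
  assumes "a \<longlonglongrightarrow> 0"
  shows "(\<lambda>n. (\<Sum>k<n. a k) / real n) \<longlonglongrightarrow> 0"
proof (rule LIMSEQ_I)
  fix e :: real assume e: "e > 0"
  then obtain m where m: "\<And>n. n \<ge> m \<Longrightarrow> \<bar>a n\<bar> < e / 2"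
    using LIMSEQ_D[OF assms, of "e / 2"] by auto
  have "(\<lambda>n. (\<Sum>k<m. \<bar>a k\<bar>) / real n) \<longlonglongrightarrow> 0" by (rule lim_const_over_n)
  then have "\<forall>\<^sub>F n in sequentially. (\<Sum>k<m. \<bar>a k\<bar>) / real n < e / 2"
    using e by (intro order_tendstoD) auto
  then have "\<forall>\<^sub>F n in sequentially. norm ((\<Sum>k<n. a k) / real n - 0) < e"
    using eventually_gt_at_top[of m]
  proof eventually_elim
    case (elim n)
    have "\<bar>\<Sum>k<n. a k\<bar> \<le> (\<Sum>k<n. \<bar>a k\<bar>)" by (rule sum_abs)
    also have "\<dots> = (\<Sum>k<m. \<bar>a k\<bar>) + (\<Sum>k\<in>{m..<n}. \<bar>a k\<bar>)"
      using elim(2) by (subst sum.union_disjoint[symmetric]) (auto intro: sum.cong)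
    also have "(\<Sum>k\<in>{m..<n}. \<bar>a k\<bar>) \<le> (\<Sum>k\<in>{m..<n}. e / 2)"
      using m by (intro sum_mono) (auto intro: less_imp_le)
    also have "\<dots> \<le> real n * (e / 2)" using e by (simp add: mult_right_mono)
    finally have "\<bar>\<Sum>k<n. a k\<bar> / real n \<le> (\<Sum>k<m. \<bar>a k\<bar>) / real n + e / 2"
      using elim(2) by (simp add: field_simps)
    then have "\<bar>\<Sum>k<n. a k\<bar> / real n < e" using elim(1) by linarith
    then show ?case by simp
  qed
  then show "\<exists>no. \<forall>n\<ge>no. norm ((\<Sum>k<n. a k) / real n - 0) < e"
    by (simp add: eventually_sequentially)
qed

lemma sum_inverse_squares_above_le:
  fixes z :: real
  assumes "z > 0"
  shows "(\<Sum>k<m. if z \<le> real (Suc k) then 1 / (real (Suc k))\<^sup>2 else 0) \<le> 2 / z"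
proof -
  define k0 where "k0 = (LEAST k. z \<le> real (Suc k))"
  obtain k1 where "z \<le> real k1" using real_arch_simple by blast
  then have "z \<le> real (Suc k1)" by simp
  then have k0: "z \<le> real (Suc k0)" unfolding k0_def by (rule LeastI)
  have le: "k0 \<le> k" if "z \<le> real (Suc k)" for k unfolding k0_def using that by (rule Least_le)
  \<comment> \<open>The induction carries the telescoping remainder \<open>1 / real m\<close>: later
    terms satisfy 1/(m+1)^2 \<le> 1/m - 1/(m+1), and the first admissible one is bounded separately
    by 1/(k0+1), whence the 2.\<close>
  have "(\<Sum>k<m. if z \<le> real (Suc k) then 1 / (real (Suc k))\<^sup>2 else 0)
      \<le> (if m \<le> k0 then 0 else 2 / real (Suc k0) - 1 / real m)"
  proof (induction m)
    case (Suc m)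
    show ?case
    proof (cases "Suc m \<le> k0")
      case True
      then have "\<not> z \<le> real (Suc m)" using le[of m] by auto
      then show ?thesis using Suc True by simp
    next
      case False
      have *: "1 / (real (Suc m))\<^sup>2 \<le> 1 / real m - 1 / real (Suc m)" if "m > 0"
      proof -
        have "1 / real m - 1 / real (Suc m) = 1 / (real m * real (Suc m))"
          using that by (simp add: field_simps)
        also have "\<dots> \<ge> 1 / (real (Suc m))\<^sup>2"
          using that unfolding power2_eq_square by (intro divide_left_mono mult_right_mono) auto
        finally show ?thesis .
      qed
      show ?thesis
      proof (cases "m = k0")
        case True
        have "1 / (real (Suc m))\<^sup>2 \<le> 1 / real (Suc m)"
          by (simp add: power2_eq_square divide_simps)
        then show ?thesis using Suc True by simp
      next
        case False2: False
        with False have "m > 0" "\<not> m \<le> k0" by auto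
        moreover from this have "z \<le> real (Suc m)" using k0 by linarith
        ultimately
        show ?thesis using Suc *[OF \<open>m > 0\<close>] False by simp
      qed
    qed
  qed simp
  also have "\<dots> \<le> 2 / real (Suc k0)" by simp
  also have "\<dots> \<le> 2 / z" using k0 assms by (intro divide_left_mono) auto
  finally show ?thesis .
qed

text \<open>Integrated over the law of \<open>z\<close>, this bounds the weighted second moments of
  variables truncated at levels \<open>Suc k\<close> by twice the first moment.\<close>

lemma sum_truncated_squares_le:
  fixes z :: real
  assumes "z \<ge> 0"
  shows "(\<Sum>k<m. (if z \<le> real (Suc k) then z else 0)\<^sup>2 / (real (Suc k))\<^sup>2) \<le> 2 * z"
proof (cases "z = 0")
  case False
  with assms have z: "z > 0" by simp
  have "(\<Sum>k<m. (if z \<le> real (Suc k) then z else 0)\<^sup>2 / (real (Suc k))\<^sup>2)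
      = z\<^sup>2 * (\<Sum>k<m. if z \<le> real (Suc k) then 1 / (real (Suc k))\<^sup>2 else 0)"
    unfolding sum_distrib_left by (intro sum.cong) auto
  also have "\<dots> \<le> z\<^sup>2 * (2 / z)"
    using sum_inverse_squares_above_le[OF z] by (intro mult_left_mono) auto
  also have "\<dots> = 2 * z" using z by (simp add: power2_eq_square)
  finally show ?thesis .
qed simp

text \<open>The sum counts levels below \<open>z\<close>. Integrated, it bounds the sum of the
  probabilities of exceeding the truncation levels by the first moment.\<close>

lemma sum_exceedances_le:
  fixes z :: real
  assumes "z \<ge> 0"
  shows "(\<Sum>k<m. if z \<le> real (Suc k) then 0 else 1) \<le> z"
proof -
  have "(\<Sum>k<m. if z \<le> real (Suc k) then 0 else 1) \<le> min z (real m)"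
  proof (induction m)
    case (Suc m)
    then show ?case by auto
  qed (use assms in simp)
  then show ?thesis by simp
qed

section \<open>The increments of the delayed process\<close>

locale regime_walk = delayed_process +
  assumes incr: "increment_distributions l P"
begin

abbreviation \<xi> :: "nat \<Rightarrow> 'a \<Rightarrow> real" where
  "\<xi> n \<omega> \<equiv> X (Suc n) \<omega> - X n \<omega>"

abbreviation filt :: "nat \<Rightarrow> 'a measure" where
  "filt n \<equiv> past M X J n"

lemma P_prob: "i \<le> l \<Longrightarrow> prob_space (P i)"
  and P_sets: "i \<le> l \<Longrightarrow> sets (P i) = sets borel"
  and P_integrable: "i \<le> l \<Longrightarrow> integrable (P i) (\<lambda>x. x)"
  using incr by (auto simp: increment_distributions_def)

section \<open>The filtration generated by positions and regimes\<close>

lemma space_filt [simp]: "space (filt n) = space M"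
  by (simp add: past_def)

lemma
  assumes "k \<le> n"
  shows X_filt: "X k \<in> borel_measurable (filt n)"
    and J_filt: "J k \<in> measurable (filt n) (count_space UNIV)"
proof -
  have "(\<lambda>\<omega>. \<lambda>k\<in>{..n}. (X k \<omega>, J k \<omega>)) \<in> measurable (filt n) (\<Pi>\<^sub>M k\<in>{..n}. borel \<Otimes>\<^sub>M count_space UNIV)"
    unfolding past_def by (rule measurable_vimage_algebra1) (auto simp: space_PiM space_pair_measure)
  then have "(\<lambda>\<omega>. (\<lambda>k\<in>{..n}. (X k \<omega>, J k \<omega>)) k) \<in> measurable (filt n) (borel \<Otimes>\<^sub>M count_space UNIV)"
    by (rule measurable_compose) (use assms in simp)
  then have *: "(\<lambda>\<omega>. (X k \<omega>, J k \<omega>)) \<in> measurable (filt n) (borel \<Otimes>\<^sub>M count_space UNIV)"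
    using assms by simp
  show "X k \<in> borel_measurable (filt n)"
    using measurable_compose[OF * measurable_fst] by simp
  show "J k \<in> measurable (filt n) (count_space UNIV)"
    using measurable_compose[OF * measurable_snd] by simp
qed

text \<open>Minimality of the generated sigma-algebra; taking \<open>S\<close> to be
  \<open>M\<close> or a later past yields both subalgebra relations.\<close>

lemma filt_least:
  assumes "space S = space M"
    and [measurable]: "\<And>k. k \<le> n \<Longrightarrow> X k \<in> borel_measurable S"
      "\<And>k. k \<le> n \<Longrightarrow> J k \<in> measurable S (count_space UNIV)"
  shows "sets (filt n) \<subseteq> sets S"
  unfolding past_def
proof (rule sets_image_in_sets[OF assms(1)])
  show "(\<lambda>\<omega>. \<lambda>k\<in>{..n}. (X k \<omega>, J k \<omega>)) \<in> measurable S (\<Pi>\<^sub>M k\<in>{..n}. borel \<Otimes>\<^sub>M count_space UNIV)"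
    by (rule measurable_restrict) (use assms(2,3) in \<open>auto intro!: measurable_Pair\<close>)
qed

lemma subalgebra_filt: "subalgebra M (filt n)"
  unfolding subalgebra_def using filt_least[of M] X_measurable J_measurable by simp

lemma subalgebra_filt_mono: "m \<le> n \<Longrightarrow> subalgebra (filt n) (filt m)"
  unfolding subalgebra_def using filt_least[of "filt n" m] X_filt J_filt by simp

lemmas filt_measurable_M = measurable_from_subalg[OF subalgebra_filt]
lemmas filt_measurable_mono = measurable_from_subalg[OF subalgebra_filt_mono]

lemma in_regime_filt [measurable]: "k \<le> n \<Longrightarrow> (\<lambda>\<omega>. indicat_real {i} (J k \<omega>)) \<in> borel_measurable (filt n)"
  by (rule measurable_compose[OF J_filt]) simp_all

lemma in_regime_M [measurable]: "(\<lambda>\<omega>. indicat_real {i} (J k \<omega>)) \<in> borel_measurable M"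
  by (rule measurable_compose[OF J_measurable]) simp_all

declare X_measurable [measurable]

lemma integrable_in_regime:
  assumes f: "f \<in> borel_measurable M" and bound: "\<And>\<omega>. \<omega> \<in> space M \<Longrightarrow> \<bar>f \<omega> :: real\<bar> \<le> B"
  shows "integrable M (\<lambda>\<omega>. indicator {i} (J n \<omega>) * f \<omega>)"
proof (rule integrable_const_bound)
  show "AE \<omega> in M. norm (indicator {i} (J n \<omega>) * f \<omega>) \<le> B"
  proof (rule AE_I2)
    fix \<omega> assume "\<omega> \<in> space M"
    from bound[OF this] show "norm (indicator {i} (J n \<omega>) * f \<omega>) \<le> B"
      by (cases "J n \<omega> = i") auto
  qed
qed (intro borel_measurable_times in_regime_M f)

text \<open>The axiom on conditional laws enters here: on a past event inside \<open>J n = i\<close>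
  the random kernel \<open>P (J n \<omega>)\<close> is the fixed measure \<open>P i\<close>, so
  conditioning becomes a product formula.\<close>

lemma measure_increment:
  assumes A: "A \<in> sets (filt n)" and AJ: "\<And>\<omega>. \<omega> \<in> A \<Longrightarrow> J n \<omega> = i" and B [measurable]: "B \<in> sets borel"
  shows "measure M {\<omega> \<in> A. \<xi> n \<omega> \<in> B} = measure M A * measure (P i) B"
proof -
  interpret finite_measure_subalgebra M "filt n"
    by unfold_locales (rule subalgebra_filt)
  have [measurable]: "A \<in> sets M" using A subalgebra_filt by (auto simp: subalgebra_def)
  have "{\<omega> \<in> A. \<xi> n \<omega> \<in> B} = A \<inter> {\<omega> \<in> space M. \<xi> n \<omega> \<in> B}"
    using sets.sets_into_space[OF \<open>A \<in> sets M\<close>] by auto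
  then have [measurable]: "{\<omega> \<in> A. \<xi> n \<omega> \<in> B} \<in> sets M" by simp
  have "measure M {\<omega> \<in> A. \<xi> n \<omega> \<in> B} = (\<integral>\<omega>. indicator {\<omega> \<in> A. \<xi> n \<omega> \<in> B} \<omega> \<partial>M)"
    by simp
  also have "\<dots> = (\<integral>\<omega>\<in>A. indicat_real B (\<xi> n \<omega>) \<partial>M)"
    unfolding set_lebesgue_integral_def
    by (intro Bochner_Integration.integral_cong) (auto simp: indicator_def)
  also have "\<dots> = (\<integral>\<omega>\<in>A. real_cond_exp M (filt n) (\<lambda>\<omega>. indicat_real B (\<xi> n \<omega>)) \<omega> \<partial>M)"
    by (rule real_cond_exp_intA[OF _ A])
      (rule integrable_const_bound[of _ 1], auto simp: indicator_def)
  also have "\<dots> = (\<integral>\<omega>\<in>A. measure (P i) B \<partial>M)"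
    unfolding set_lebesgue_integral_def
  proof (rule integral_cong_AE)
    show "AE \<omega> in M. indicat_real A \<omega> *\<^sub>R real_cond_exp M (filt n) (\<lambda>\<omega>. indicat_real B (\<xi> n \<omega>)) \<omega>
       = indicat_real A \<omega> *\<^sub>R measure (P i) B"
      using increment[OF B, of n] by eventually_elim (auto simp: indicator_def AJ)
  qed measurable
  also have "\<dots> = measure M A * measure (P i) B" 
    by (simp add: set_lebesgue_integral_def)
  finally show ?thesis .
qed

lemma measurable_kernel_integral:
  assumes i: "i \<le> l" and g: "case_prod g \<in> borel_measurable (S \<Otimes>\<^sub>M borel)"
  shows "(\<lambda>\<omega>. \<integral>x. (g \<omega> x :: real) \<partial>P i) \<in> borel_measurable S"
proof -
  interpret Pi: prob_space "P i" using P_prob[OF i] .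
  have "sets (S \<Otimes>\<^sub>M P i) = sets (S \<Otimes>\<^sub>M borel)"
    by (intro sets_pair_measure_cong refl P_sets i)
  then have "case_prod g \<in> borel_measurable (S \<Otimes>\<^sub>M P i)"
    using g measurable_cong_sets by blast
  then show ?thesis by (rule Pi.borel_measurable_lebesgue_integral)
qed

lemma section_measurable:
  assumes i: "i \<le> l" and g: "case_prod g \<in> borel_measurable (S \<Otimes>\<^sub>M borel)" and "\<omega> \<in> space S"
  shows "(\<lambda>x. g \<omega> x :: real) \<in> borel_measurable (P i)"
proof -
  have "(\<lambda>x. g \<omega> x) \<in> borel_measurable borel"
    using measurable_compose[OF measurable_Pair1'[OF assms(3)] g] by simp
  then show ?thesis using measurable_cong_sets P_sets[OF i] by blast
qed

lemma case_prod_increment_measurable: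
  assumes g: "case_prod g \<in> borel_measurable (filt n \<Otimes>\<^sub>M borel)"
  shows "(\<lambda>\<omega>. g \<omega> (\<xi> n \<omega>) :: real) \<in> borel_measurable M"
    and "n < m \<Longrightarrow> (\<lambda>\<omega>. g \<omega> (\<xi> n \<omega>)) \<in> borel_measurable (filt m)"
proof -
  have id: "(\<lambda>\<omega>. \<omega>) \<in> measurable M (filt n)"
    using filt_measurable_M[of "\<lambda>\<omega>. \<omega>" n "filt n"] by simp
  have "(\<lambda>\<omega>. (\<omega>, \<xi> n \<omega>)) \<in> measurable M (filt n \<Otimes>\<^sub>M borel)"
    by (intro measurable_Pair id borel_measurable_diff X_measurable)
  from measurable_compose[OF this g] show "(\<lambda>\<omega>. g \<omega> (\<xi> n \<omega>)) \<in> borel_measurable M" by simp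
  assume "n < m"
  then have X: "X n \<in> borel_measurable (filt m)" "X (Suc n) \<in> borel_measurable (filt m)"
    by (auto intro: X_filt)
  have id: "(\<lambda>\<omega>. \<omega>) \<in> measurable (filt m) (filt n)"
    using filt_measurable_mono[of n m "\<lambda>\<omega>. \<omega>" "filt n"] \<open>n < m\<close> by simp
  have "(\<lambda>\<omega>. (\<omega>, \<xi> n \<omega>)) \<in> measurable (filt m) (filt n \<Otimes>\<^sub>M borel)"
    by (intro measurable_Pair id borel_measurable_diff X)
  from measurable_compose[OF this g] show "(\<lambda>\<omega>. g \<omega> (\<xi> n \<omega>)) \<in> borel_measurable (filt m)" by simp
qed

text \<open>On \<open>J n = i\<close> the past and the next increment have a product law with factor
  \<open>P i\<close>: rectangles determine the joint law, and Fubini integrates out the increment.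
  Since \<open>g\<close> may depend on the whole past, age, window and earlier martingale
  differences can serve as parameters.\<close>

lemma disintegration:
  assumes i: "i \<le> l" and g: "case_prod g \<in> borel_measurable (filt n \<Otimes>\<^sub>M borel)"
    and bound: "\<And>\<omega> x. \<omega> \<in> space M \<Longrightarrow> \<bar>g \<omega> x :: real\<bar> \<le> C"
  shows "(\<integral>\<omega>. indicator {i} (J n \<omega>) * g \<omega> (\<xi> n \<omega>) \<partial>M)
       = (\<integral>\<omega>. indicator {i} (J n \<omega>) * (\<integral>x. g \<omega> x \<partial>P i) \<partial>M)"
proof -
  interpret Pi: prob_space "P i" using P_prob[OF i] .
  \<comment> \<open>Weighting by the indicator instead of conditioning also covers the case that
    \<open>J n = i\<close> is a null event.\<close>
  define Mi where "Mi = density M (\<lambda>\<omega>. ennreal (indicat_real {i} (J n \<omega>)))"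
  have sets_Mi [measurable_cong, simp]: "sets Mi = sets M" and space_Mi [simp]: "space Mi = space M"
    by (auto simp: Mi_def)
  have em: "emeasure Mi A = emeasure M {\<omega> \<in> A. J n \<omega> = i}" if "A \<in> sets M" for A
  proof -
    have [measurable]: "{\<omega> \<in> space M. J n \<omega> = i} \<in> sets M"
      using J_measurable[of n] by measurable
    have "emeasure Mi A = (\<integral>\<^sup>+\<omega>. indicator (A \<inter> {\<omega> \<in> space M. J n \<omega> = i}) \<omega> \<partial>M)"
      unfolding Mi_def using that
      by (subst emeasure_density) (auto intro!: nn_integral_cong simp: indicator_def simp del: nn_integral_indicator)
    also have "\<dots> = emeasure M (A \<inter> {\<omega> \<in> space M. J n \<omega> = i})"
      using that by (subst nn_integral_indicator) auto
    also have "A \<inter> {\<omega> \<in> space M. J n \<omega> = i} = {\<omega> \<in> A. J n \<omega> = i}"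
      using sets.sets_into_space[OF that] by auto
    finally show ?thesis .
  qed
  have fin: "finite_measure Mi"
    by (rule finite_measureI) (simp add: em emeasure_eq_measure)
  have sub: "subalgebra Mi (filt n)" using subalgebra_filt by (simp add: subalgebra_def)
  \<comment> \<open>The product formula is available for past events, hence the first factor lives
    on the coarser sigma-algebra.\<close>
  define R where "R = restr_to_subalg Mi (filt n)"
  interpret R: finite_measure R
    unfolding R_def by (rule finite_measure_restr_to_subalg[OF sub fin])
  have sets_R: "sets R = sets (filt n)" unfolding R_def by (rule sets_restr_to_subalg[OF sub])
  interpret RP: pair_sigma_finite R "P i" ..
  interpret RPf: finite_measure "R \<Otimes>\<^sub>M P i"
    by (rule finite_measure_pair_measure) (rule R.finite_measure_axioms Pi.finite_measure_axioms)+
  have pair_sets: "sets (R \<Otimes>\<^sub>M P i) = sets (filt n \<Otimes>\<^sub>M borel)"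
    by (intro sets_pair_measure_cong sets_R P_sets i)
  have "(\<lambda>\<omega>. \<omega>) \<in> measurable Mi (filt n)"
    by (rule measurable_from_subalg[OF sub]) simp
  then have meas: "(\<lambda>\<omega>. (\<omega>, \<xi> n \<omega>)) \<in> measurable Mi (filt n \<Otimes>\<^sub>M borel)"
    by (rule measurable_Pair) measurable
  have eq: "R \<Otimes>\<^sub>M P i = distr Mi (filt n \<Otimes>\<^sub>M borel) (\<lambda>\<omega>. (\<omega>, \<xi> n \<omega>))"
  proof (rule pair_measure_eqI)
    fix A B assume A: "A \<in> sets R" and "B \<in> sets (P i)"
    then have B [measurable]: "B \<in> sets borel" using P_sets[OF i] by simp
    have A': "A \<in> sets (filt n)" using A sets_R by simp
    then have AM [measurable]: "A \<in> sets M" using subalgebra_filt by (auto simp: subalgebra_def)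
    have Asp: "A \<subseteq> space M" using sets.sets_into_space[OF AM] .
    have AJ: "{\<omega> \<in> A. J n \<omega> = i} \<in> sets (filt n)"
    proof -
      have "{\<omega> \<in> space (filt n). J n \<omega> = i} \<in> sets (filt n)"
        using J_filt[of n n] by measurable
      moreover have "{\<omega> \<in> A. J n \<omega> = i} = A \<inter> {\<omega> \<in> space (filt n). J n \<omega> = i}" using Asp by auto
      ultimately show ?thesis using A' by simp
    qed
    have pre: "(\<lambda>\<omega>. (\<omega>, \<xi> n \<omega>)) -` (A \<times> B) \<inter> space Mi = A \<inter> {\<omega> \<in> space M. \<xi> n \<omega> \<in> B}"
      by auto
    have "emeasure (distr Mi (filt n \<Otimes>\<^sub>M borel) (\<lambda>\<omega>. (\<omega>, \<xi> n \<omega>))) (A \<times> B)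
        = emeasure M {\<omega> \<in> {\<omega> \<in> A. J n \<omega> = i}. \<xi> n \<omega> \<in> B}"
      using A' Asp by (subst emeasure_distr[OF meas]) (auto simp: pre em intro!: arg_cong[where f = "emeasure M"])
    also have "\<dots> = ennreal (measure M {\<omega> \<in> A. J n \<omega> = i} * measure (P i) B)"
      unfolding emeasure_eq_measure using measure_increment[OF AJ _ B, of i] by simp
    also have "\<dots> = emeasure R A * emeasure (P i) B"
      unfolding R_def using A' AM
      by (simp add: emeasure_restr_to_subalg[OF sub] em emeasure_eq_measure Pi.emeasure_eq_measure ennreal_mult)
    finally show "emeasure R A * emeasure (P i) B
        = emeasure (distr Mi (filt n \<Otimes>\<^sub>M borel) (\<lambda>\<omega>. (\<omega>, \<xi> n \<omega>))) (A \<times> B)" by simp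
  qed (use pair_sets in \<open>auto intro: R.sigma_finite_measure Pi.sigma_finite_measure_axioms R.sigma_finite_measure_axioms\<close>)
  have g': "case_prod g \<in> borel_measurable (R \<Otimes>\<^sub>M P i)"
    using g pair_sets measurable_cong_sets by blast
  have int: "integrable (R \<Otimes>\<^sub>M P i) (case_prod g)"
  proof (rule RPf.integrable_const_bound[OF _ g'])
    show "AE x in R \<Otimes>\<^sub>M P i. norm (case_prod g x) \<le> C"
      by (rule AE_I2) (auto simp: space_pair_measure R_def space_restr_to_subalg bound)
  qed
  have kint: "(\<lambda>\<omega>. \<integral>x. g \<omega> x \<partial>P i) \<in> borel_measurable (filt n)"
    by (rule measurable_kernel_integral[OF i g])
  have "(\<integral>\<omega>. indicator {i} (J n \<omega>) * g \<omega> (\<xi> n \<omega>) \<partial>M) = (\<integral>\<omega>. g \<omega> (\<xi> n \<omega>) \<partial>Mi)"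
    unfolding Mi_def using case_prod_increment_measurable(1)[OF g]
    by (subst integral_density) auto
  also have "\<dots> = (\<integral>p. case_prod g p \<partial>distr Mi (filt n \<Otimes>\<^sub>M borel) (\<lambda>\<omega>. (\<omega>, \<xi> n \<omega>)))"
    by (subst integral_distr[OF meas g]) simp
  also have "\<dots> = (\<integral>\<omega>. (\<integral>x. g \<omega> x \<partial>P i) \<partial>R)"
    unfolding eq[symmetric] using RP.integral_fst'[OF int] by simp
  also have "\<dots> = (\<integral>\<omega>. (\<integral>x. g \<omega> x \<partial>P i) \<partial>Mi)"
    unfolding R_def by (rule integral_subalgebra2[OF sub kint])
  also have "\<dots> = (\<integral>\<omega>. indicator {i} (J n \<omega>) * (\<integral>x. g \<omega> x \<partial>P i) \<partial>M)"
    unfolding Mi_def using filt_measurable_M[OF kint]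
    by (subst integral_density) auto
  finally show ?thesis .
qed

text \<open>The terms are martingale differences for the past, hence orthogonal, with variance at
  most the expected second moment. The bound \<open>K n\<close> secures integrability and may grow,
  as truncation levels do; the lower bound \<open>C\<close> has to be uniform.\<close>

lemma strong_law_increments:
  assumes i: "i \<le> l" and g: "\<And>n. case_prod (g n) \<in> borel_measurable (filt n \<Otimes>\<^sub>M borel)"
    and bound: "\<And>n \<omega> x. \<omega> \<in> space M \<Longrightarrow> \<bar>g n \<omega> x :: real\<bar> \<le> K n"
    and lower: "\<And>n \<omega> x. \<omega> \<in> space M \<Longrightarrow> - C \<le> g n \<omega> x - (\<integral>x. g n \<omega> x \<partial>P i)" and C: "C \<ge> 0"
    and sm: "summable (\<lambda>n. (\<integral>\<omega>. indicator {i} (J n \<omega>) * (\<integral>x. (g n \<omega> x)\<^sup>2 \<partial>P i) \<partial>M) / (real (Suc n))\<^sup>2)"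
  shows "AE \<omega> in M. (\<lambda>n. (\<Sum>k<n. indicator {i} (J k \<omega>) *
           (g k \<omega> (\<xi> k \<omega>) - (\<integral>x. g k \<omega> x \<partial>P i))) / real n) \<longlonglongrightarrow> 0"
proof -
  interpret Pi: prob_space "P i" using P_prob[OF i] .
  define G where "G = (\<lambda>n \<omega>. \<integral>x. g n \<omega> x \<partial>P i)"
  define D where "D = (\<lambda>n \<omega>. indicat_real {i} (J n \<omega>) * (g n \<omega> (\<xi> n \<omega>) - G n \<omega>))"
  have G: "G n \<in> borel_measurable (filt n)" for n
    unfolding G_def by (rule measurable_kernel_integral[OF i g])
  have K: "0 \<le> K n" for n using bound[of _ n undefined] not_empty by fastforce
  have sec: "(\<lambda>x. g n \<omega> x) \<in> borel_measurable (P i)" if "\<omega> \<in> space M" for n \<omega>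
    using section_measurable[OF i g] that by simp
  have int: "integrable (P i) (\<lambda>x. g n \<omega> x)" and int2: "integrable (P i) (\<lambda>x. (g n \<omega> x)\<^sup>2)"
    if "\<omega> \<in> space M" for n \<omega>
  proof -
    show "integrable (P i) (\<lambda>x. g n \<omega> x)"
      by (rule Pi.integrable_const_bound[where B = "K n"]) (use that sec bound in auto)
    show "integrable (P i) (\<lambda>x. (g n \<omega> x)\<^sup>2)"
      by (rule Pi.integrable_const_bound[where B = "(K n)\<^sup>2"])
        (use that sec bound K in \<open>auto simp: abs_le_square_iff[symmetric]\<close>)
  qed
  have Gbound: "\<bar>G n \<omega>\<bar> \<le> K n" if "\<omega> \<in> space M" for n \<omega>
  proof -
    have "\<bar>G n \<omega>\<bar> \<le> (\<integral>x. \<bar>g n \<omega> x\<bar> \<partial>P i)" unfolding G_def by (rule integral_abs_bound)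
    also have "\<dots> \<le> (\<integral>x. K n \<partial>P i)"
      using bound[OF that] int[OF that] by (intro integral_mono) auto
    finally show ?thesis by (simp add: Pi.prob_space)
  qed
  have Dm: "D n \<in> borel_measurable (filt m)" if "n < m" for n m
    unfolding D_def using that case_prod_increment_measurable(2)[OF g that]
      filt_measurable_mono[OF _ G, of n m]
    by (intro borel_measurable_times borel_measurable_diff in_regime_filt) auto
  have DM: "D n \<in> borel_measurable M" for n
    using Dm[of n "Suc n"] filt_measurable_M by blast
  have Dbound: "\<bar>D n \<omega>\<bar> \<le> 2 * K n" if "\<omega> \<in> space M" for n \<omega>
    using bound[OF that, of n "\<xi> n \<omega>"] Gbound[OF that, of n] K[of n]
    by (auto simp: D_def indicator_def)
  have Dsq: "integrable M (\<lambda>\<omega>. (D n \<omega>)\<^sup>2)" for n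
  proof (rule integrable_const_bound[where B = "(2 * K n)\<^sup>2"])
    show "AE \<omega> in M. norm ((D n \<omega>)\<^sup>2) \<le> (2 * K n)\<^sup>2"
    proof (rule AE_I2)
      fix \<omega> assume "\<omega> \<in> space M"
      then have "\<bar>D n \<omega>\<bar> \<le> \<bar>2 * K n\<bar>" using Dbound[of \<omega> n] by linarith
      then show "norm ((D n \<omega>)\<^sup>2) \<le> (2 * K n)\<^sup>2" by (simp only: abs_le_square_iff real_norm_def abs_power2)
    qed
  qed (use DM in measurable)
  have orth: "(\<integral>\<omega>. D j \<omega> * D n \<omega> \<partial>M) = 0" if "j < n" for j n
  proof -
    \<comment> \<open>\<open>D j\<close> is already known at time \<open>n\<close>, so it is a
      parameter of the integrand; integrating out the increment then replaces \<open>g n\<close> by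
      its mean \<open>G n\<close>.\<close>
    have meas: "(\<lambda>(\<omega>, x). D j \<omega> * g n \<omega> x) \<in> borel_measurable (filt n \<Otimes>\<^sub>M borel)"
      using borel_measurable_times[OF measurable_compose[OF measurable_fst Dm[OF that]] g[of n]]
      by (simp add: case_prod_beta')
    have *: "(\<integral>\<omega>. indicator {i} (J n \<omega>) * (D j \<omega> * g n \<omega> (\<xi> n \<omega>)) \<partial>M)
        = (\<integral>\<omega>. indicator {i} (J n \<omega>) * (\<integral>x. D j \<omega> * g n \<omega> x \<partial>P i) \<partial>M)"
    proof (rule disintegration[OF i meas])
      fix \<omega> x assume "\<omega> \<in> space M"
      then show "\<bar>D j \<omega> * g n \<omega> x\<bar> \<le> 2 * K j * K n"
        using Dbound[of \<omega> j] bound[of \<omega> n x] K by (simp add: abs_mult mult_mono)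
    qed
    have b1: "integrable M (\<lambda>\<omega>. indicator {i} (J n \<omega>) * (D j \<omega> * g n \<omega> (\<xi> n \<omega>)))"
      and b2: "integrable M (\<lambda>\<omega>. indicator {i} (J n \<omega>) * (D j \<omega> * G n \<omega>))"
    proof -
      have "\<bar>D j \<omega> * g n \<omega> (\<xi> n \<omega>)\<bar> \<le> 2 * K j * K n" "\<bar>D j \<omega> * G n \<omega>\<bar> \<le> 2 * K j * K n"
        if "\<omega> \<in> space M" for \<omega>
        using Dbound[OF that, of j] bound[OF that, of n] Gbound[OF that, of n] K
        unfolding abs_mult by (auto intro!: mult_mono)
      then show "integrable M (\<lambda>\<omega>. indicator {i} (J n \<omega>) * (D j \<omega> * g n \<omega> (\<xi> n \<omega>)))"
        "integrable M (\<lambda>\<omega>. indicator {i} (J n \<omega>) * (D j \<omega> * G n \<omega>))"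
        using DM case_prod_increment_measurable(1)[OF g] filt_measurable_M[OF G]
        by (auto intro!: integrable_in_regime[where B = "2 * K j * K n"] borel_measurable_times)
    qed
    have "(\<integral>\<omega>. D j \<omega> * D n \<omega> \<partial>M) = (\<integral>\<omega>. indicator {i} (J n \<omega>) * (D j \<omega> * g n \<omega> (\<xi> n \<omega>))
        - indicator {i} (J n \<omega>) * (D j \<omega> * G n \<omega>) \<partial>M)"
      by (rule Bochner_Integration.integral_cong) (auto simp: D_def algebra_simps)
    also have "\<dots> = 0"
      using b1 b2 * by (simp add: G_def)
    finally show ?thesis .
  qed
  have Dvar: "(\<integral>\<omega>. (D n \<omega>)\<^sup>2 \<partial>M) \<le> (\<integral>\<omega>. indicator {i} (J n \<omega>) * (\<integral>x. (g n \<omega> x)\<^sup>2 \<partial>P i) \<partial>M)" for n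
  proof -
    have meas: "(\<lambda>(\<omega>, x). (g n \<omega> x - G n \<omega>)\<^sup>2) \<in> borel_measurable (filt n \<Otimes>\<^sub>M borel)"
      "(\<lambda>(\<omega>, x). (g n \<omega> x)\<^sup>2) \<in> borel_measurable (filt n \<Otimes>\<^sub>M borel)"
      using borel_measurable_power[OF borel_measurable_diff[OF g[of n] measurable_compose[OF measurable_fst G]], of 2]
        borel_measurable_power[OF g[of n], of 2]
      by (simp_all add: case_prod_beta')
    have sqb: "\<bar>(g n \<omega> x - G n \<omega>)\<^sup>2\<bar> \<le> (2 * K n)\<^sup>2" if "\<omega> \<in> space M" for \<omega> x
    proof -
      have "\<bar>g n \<omega> x - G n \<omega>\<bar> \<le> \<bar>2 * K n\<bar>"
        using bound[OF that, of n x] Gbound[OF that, of n] by linarith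
      then show ?thesis by (simp only: abs_le_square_iff abs_power2)
    qed
    have v: "(\<integral>x. (g n \<omega> x - G n \<omega>)\<^sup>2 \<partial>P i) \<le> (\<integral>x. (g n \<omega> x)\<^sup>2 \<partial>P i)" 
      and v0: "0 \<le> (\<integral>x. (g n \<omega> x - G n \<omega>)\<^sup>2 \<partial>P i)"
      and vK: "(\<integral>x. (g n \<omega> x)\<^sup>2 \<partial>P i) \<le> (K n)\<^sup>2"
      if "\<omega> \<in> space M" for \<omega>
    proof -
      have "(\<integral>x. (g n \<omega> x - G n \<omega>)\<^sup>2 \<partial>P i) = (\<integral>x. (g n \<omega> x)\<^sup>2 \<partial>P i) - (\<integral>x. g n \<omega> x \<partial>P i)\<^sup>2"
        unfolding G_def by (rule Pi.variance_eq) (use int int2 that in auto)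
      then show "(\<integral>x. (g n \<omega> x - G n \<omega>)\<^sup>2 \<partial>P i) \<le> (\<integral>x. (g n \<omega> x)\<^sup>2 \<partial>P i)" by simp
      have "(\<integral>x. (g n \<omega> x)\<^sup>2 \<partial>P i) \<le> (\<integral>x. (K n)\<^sup>2 \<partial>P i)"
        using int2 that bound[OF that] K by (intro integral_mono) (auto simp: abs_le_square_iff[symmetric])
      then show "(\<integral>x. (g n \<omega> x)\<^sup>2 \<partial>P i) \<le> (K n)\<^sup>2" by (simp add: Pi.prob_space)
    qed simp
    have "(\<integral>\<omega>. (D n \<omega>)\<^sup>2 \<partial>M) = (\<integral>\<omega>. indicator {i} (J n \<omega>) * (g n \<omega> (\<xi> n \<omega>) - G n \<omega>)\<^sup>2 \<partial>M)"
      by (rule Bochner_Integration.integral_cong) (auto simp: D_def indicator_def)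
    also have "\<dots> = (\<integral>\<omega>. indicator {i} (J n \<omega>) * (\<integral>x. (g n \<omega> x - G n \<omega>)\<^sup>2 \<partial>P i) \<partial>M)"
      by (rule disintegration[OF i meas(1) sqb])
    also have "\<dots> \<le> (\<integral>\<omega>. indicator {i} (J n \<omega>) * (\<integral>x. (g n \<omega> x)\<^sup>2 \<partial>P i) \<partial>M)"
    proof (rule integral_mono)
      have m1: "(\<lambda>\<omega>. \<integral>x. (g n \<omega> x - G n \<omega>)\<^sup>2 \<partial>P i) \<in> borel_measurable M"
        "(\<lambda>\<omega>. \<integral>x. (g n \<omega> x)\<^sup>2 \<partial>P i) \<in> borel_measurable M"
        using filt_measurable_M[OF measurable_kernel_integral[OF i meas(1)]]
          filt_measurable_M[OF measurable_kernel_integral[OF i meas(2)]] by auto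
      show "integrable M (\<lambda>\<omega>. indicator {i} (J n \<omega>) * (\<integral>x. (g n \<omega> x - G n \<omega>)\<^sup>2 \<partial>P i))"
        "integrable M (\<lambda>\<omega>. indicator {i} (J n \<omega>) * (\<integral>x. (g n \<omega> x)\<^sup>2 \<partial>P i))"
        using m1 v0 vK order_trans[OF v vK]
        by (auto intro!: integrable_in_regime[where B = "(K n)\<^sup>2"])
    qed (use v in \<open>auto simp: indicator_def\<close>)
    finally show ?thesis .
  qed
  have "AE \<omega> in M. (\<lambda>n. (\<Sum>k<n. D k \<omega>) / real n) \<longlonglongrightarrow> 0"
  proof (rule strong_law_orthogonal[OF DM Dsq orth])
    fix n \<omega> assume "\<omega> \<in> space M"
    then show "- C \<le> D n \<omega>" using lower[of \<omega> n "\<xi> n \<omega>"] C by (auto simp: D_def G_def indicator_def)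
  next
    show "summable (\<lambda>n. (\<integral>\<omega>. (D n \<omega>)\<^sup>2 \<partial>M) / (real (Suc n))\<^sup>2)"
      by (rule summable_comparison_test'[OF sm, of 0]) (use Dvar in \<open>auto intro!: divide_right_mono\<close>)
  qed
  then show ?thesis by (simp add: D_def G_def)
qed

lemma strong_law_bounded:
  assumes i: "i \<le> l" and g: "\<And>n. case_prod (g n) \<in> borel_measurable (filt n \<Otimes>\<^sub>M borel)"
    and bound: "\<And>n \<omega> x. \<omega> \<in> space M \<Longrightarrow> \<bar>g n \<omega> x :: real\<bar> \<le> K"
  shows "AE \<omega> in M. (\<lambda>n. (\<Sum>k<n. indicator {i} (J k \<omega>) *
           (g k \<omega> (\<xi> k \<omega>) - (\<integral>x. g k \<omega> x \<partial>P i))) / real n) \<longlonglongrightarrow> 0"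
proof (rule strong_law_increments[OF i g bound])
  interpret Pi: prob_space "P i" using P_prob[OF i] .
  have sec: "(\<lambda>x. g n \<omega> x) \<in> borel_measurable (P i)" if "\<omega> \<in> space M" for n \<omega>
    using section_measurable[OF i g] that by simp
  obtain \<omega>0 where "\<omega>0 \<in> space M" using not_empty by blast
  from bound[OF this, of 0 0] have K: "K \<ge> 0" by linarith
  then show "0 \<le> 2 * K" by simp
  fix n
  have sq: "(\<integral>x. (g n \<omega> x)\<^sup>2 \<partial>P i) \<le> K\<^sup>2" if "\<omega> \<in> space M" for \<omega>
  proof -
    have "(\<integral>x. (g n \<omega> x)\<^sup>2 \<partial>P i) \<le> (\<integral>x. K\<^sup>2 \<partial>P i)"
      using sec[OF that] bound[OF that] K
      by (intro integral_mono Pi.integrable_const_bound[where B = "K\<^sup>2"])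
        (auto simp: abs_le_square_iff[symmetric])
    then show ?thesis by (simp add: Pi.prob_space)
  qed
  show "- (2 * K) \<le> g n \<omega> x - (\<integral>x. g n \<omega> x \<partial>P i)" if "\<omega> \<in> space M" for \<omega> x
  proof -
    have "(\<integral>x. g n \<omega> x \<partial>P i) \<le> (\<integral>x. K \<partial>P i)"
      using sec[OF that] bound[OF that] K by (intro integral_mono Pi.integrable_const_bound[where B = K]) (auto simp: abs_le_iff)
    then show ?thesis using bound[OF that, of n x] by (simp add: Pi.prob_space)
  qed
next
  interpret Pi: prob_space "P i" using P_prob[OF i] .
  obtain \<omega>0 where "\<omega>0 \<in> space M" using not_empty by blast
  from bound[OF this, of 0 0] have K: "K \<ge> 0" by linarith
  have "(\<integral>\<omega>. indicator {i} (J n \<omega>) * (\<integral>x. (g n \<omega> x)\<^sup>2 \<partial>P i) \<partial>M) \<le> (\<integral>\<omega>. K\<^sup>2 \<partial>M)" for n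
  proof (rule integral_mono')
    fix \<omega> assume \<omega>: "\<omega> \<in> space M"
    have "(\<integral>x. (g n \<omega> x)\<^sup>2 \<partial>P i) \<le> (\<integral>x. K\<^sup>2 \<partial>P i)"
      using bound[OF \<omega>] K by (intro integral_mono') (auto simp: abs_le_square_iff[symmetric])
    then show "indicator {i} (J n \<omega>) * (\<integral>x. (g n \<omega> x)\<^sup>2 \<partial>P i) \<le> K\<^sup>2"
      by (auto simp: indicator_def Pi.prob_space)
  qed auto
  then have le: "(\<integral>\<omega>. indicator {i} (J n \<omega>) * (\<integral>x. (g n \<omega> x)\<^sup>2 \<partial>P i) \<partial>M) \<le> K\<^sup>2" for n
    by (simp add: prob_space)
  have ge: "0 \<le> (\<integral>\<omega>. indicator {i} (J n \<omega>) * (\<integral>x. (g n \<omega> x)\<^sup>2 \<partial>P i) \<partial>M)" for n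
    by (intro Bochner_Integration.integral_nonneg) auto
  have "summable (\<lambda>n. K\<^sup>2 * (1 / (real (Suc n))\<^sup>2))"
    using inverse_power_summable[of 2, where 'a = real] summable_Suc_iff[of "\<lambda>n. inverse (real n ^ 2)"]
    by (intro summable_mult) (simp add: inverse_eq_divide)
  then show "summable (\<lambda>n. (\<integral>\<omega>. indicator {i} (J n \<omega>) * (\<integral>x. (g n \<omega> x)\<^sup>2 \<partial>P i) \<partial>M) / (real (Suc n))\<^sup>2)"
    by (rule summable_comparison_test'[where N = 0]) (use le ge in \<open>auto intro!: divide_right_mono\<close>)
qed

text \<open>Kolmogorov's truncation, at level \<open>Suc n\<close> for jump \<open>n\<close>. The
  first moment yields summable weighted second moments and lets truncation act only finitely often
  almost surely. Nonnegativity supplies the one-sided bound: truncation does not raise the mean, so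
  no centred term falls below minus the mean of \<open>\<phi>\<close>.\<close>

lemma strong_law_nonneg:
  assumes i: "i \<le> l" and [measurable]: "\<phi> \<in> borel_measurable borel"
    and int: "integrable (P i) \<phi>" and nn: "\<And>x. 0 \<le> (\<phi> x :: real)"
  shows "AE \<omega> in M. (\<lambda>n. (\<Sum>k<n. indicator {i} (J k \<omega>) *
           (\<phi> (\<xi> k \<omega>) - (\<integral>x. \<phi> x \<partial>P i))) / real n) \<longlonglongrightarrow> 0"
proof -
  interpret Pi: prob_space "P i" using P_prob[OF i] .
  have [measurable_cong]: "sets (P i) = sets borel" by (rule P_sets[OF i])
  define g where "g = (\<lambda>n x. if \<phi> x \<le> real (Suc n) then \<phi> x else 0)"
  have [measurable]: "g n \<in> borel_measurable borel" for n unfolding g_def by measurable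
  have g0: "0 \<le> g n x" and gn: "g n x \<le> real (Suc n)" and g\<phi>: "g n x \<le> \<phi> x" for n x
    using nn by (auto simp: g_def)
  have intg: "integrable (P i) (g n)" for n
    by (rule Bochner_Integration.integrable_bound[OF int]) (use g0 g\<phi> nn in auto)
  have intg2: "integrable (P i) (\<lambda>x. (g n x)\<^sup>2)" for n
    by (rule Pi.integrable_const_bound[where B = "(real (Suc n))\<^sup>2"])
      (use g0 gn in \<open>auto intro!: power_mono simp del: of_nat_Suc\<close>)
  have "AE \<omega> in M. (\<lambda>n. (\<Sum>k<n. indicator {i} (J k \<omega>) * (g k (\<xi> k \<omega>) - (\<integral>x. g k x \<partial>P i))) / real n) \<longlonglongrightarrow> 0"
  proof (rule strong_law_increments[OF i, where g = "\<lambda>n \<omega> x. g n x" and K = "\<lambda>n. real (Suc n)" and C = "\<integral>x. \<phi> x \<partial>P i"])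
    show "(\<lambda>(\<omega>, x). g n x) \<in> borel_measurable (filt n \<Otimes>\<^sub>M borel)" for n by measurable
    show "\<bar>g n x\<bar> \<le> real (Suc n)" for n x using g0 gn by simp
    show "0 \<le> (\<integral>x. \<phi> x \<partial>P i)" using nn by simp
    show "- (\<integral>x. \<phi> x \<partial>P i) \<le> g n x - (\<integral>x. g n x \<partial>P i)" for n x
      using integral_mono[OF intg int, of n] g\<phi> g0[of n x] by simp
    show "summable (\<lambda>n. (\<integral>\<omega>. indicator {i} (J n \<omega>) * (\<integral>x. (g n x)\<^sup>2 \<partial>P i) \<partial>M) / (real (Suc n))\<^sup>2)"
    proof (rule summable_comparison_test')
      show "summable (\<lambda>n. (\<integral>x. (g n x)\<^sup>2 \<partial>P i) / (real (Suc n))\<^sup>2)"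
      proof (rule summableI_nonneg_bounded)
        fix m
        have "(\<Sum>n<m. (\<integral>x. (g n x)\<^sup>2 \<partial>P i) / (real (Suc n))\<^sup>2) = (\<integral>x. (\<Sum>n<m. (g n x)\<^sup>2 / (real (Suc n))\<^sup>2) \<partial>P i)"
          using intg2 by (subst Bochner_Integration.integral_sum) auto
        also have "\<dots> \<le> (\<integral>x. 2 * \<phi> x \<partial>P i)"
          using intg2 int sum_truncated_squares_le[OF nn] unfolding g_def
          by (intro integral_mono) (auto simp del: of_nat_Suc)
        finally show "(\<Sum>n<m. (\<integral>x. (g n x)\<^sup>2 \<partial>P i) / (real (Suc n))\<^sup>2) \<le> (\<integral>x. 2 * \<phi> x \<partial>P i)" .
      qed simp
      fix n :: nat
      have "(\<integral>\<omega>. indicator {i} (J n \<omega>) * (\<integral>x. (g n x)\<^sup>2 \<partial>P i) \<partial>M) \<le> (\<integral>\<omega>. (\<integral>x. (g n x)\<^sup>2 \<partial>P i) \<partial>M)"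
        by (rule integral_mono') (auto simp: indicator_def)
      then show "norm ((\<integral>\<omega>. indicator {i} (J n \<omega>) * (\<integral>x. (g n x)\<^sup>2 \<partial>P i) \<partial>M) / (real (Suc n))\<^sup>2)
          \<le> (\<integral>x. (g n x)\<^sup>2 \<partial>P i) / (real (Suc n))\<^sup>2"
        by (auto intro!: divide_right_mono simp: prob_space)
    qed
  qed
  \<comment> \<open>These indicators mark the jumps whose value truncation changes; being 0 or 1 and
    tending to 0, they are eventually 0.\<close>
  moreover have "AE \<omega> in M. (\<lambda>n. indicat_real {i} (J n \<omega>) * (if \<phi> (\<xi> n \<omega>) \<le> real (Suc n) then 0 else 1)) \<longlonglongrightarrow> 0"
  proof (rule AE_LIMSEQ_0_of_summable_integral)
    define h :: "nat \<Rightarrow> real \<Rightarrow> real" where "h = (\<lambda>n x. if \<phi> x \<le> real (Suc n) then 0 else 1)"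
    have [measurable]: "h n \<in> borel_measurable borel" for n unfolding h_def by measurable
    have inth: "integrable (P i) (h n)" for n
      by (rule Pi.integrable_const_bound[where B = 1]) (auto simp: h_def)
    show "integrable M (\<lambda>\<omega>. indicat_real {i} (J n \<omega>) * (if \<phi> (\<xi> n \<omega>) \<le> real (Suc n) then 0 else 1))" for n
    proof (rule integrable_const_bound[where B = 1])
      show "(\<lambda>\<omega>. indicat_real {i} (J n \<omega>) * (if \<phi> (\<xi> n \<omega>) \<le> real (Suc n) then 0 else 1)) \<in> borel_measurable M"
        by measurable
    qed (auto simp: indicator_def)
    have eq: "(\<integral>\<omega>. indicat_real {i} (J n \<omega>) * h n (\<xi> n \<omega>) \<partial>M) = (\<integral>\<omega>. indicat_real {i} (J n \<omega>) * (\<integral>x. h n x \<partial>P i) \<partial>M)" for n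
      by (rule disintegration[OF i, where C = 1]) (auto simp: h_def)
    show "summable (\<lambda>n. \<integral>\<omega>. indicat_real {i} (J n \<omega>) * (if \<phi> (\<xi> n \<omega>) \<le> real (Suc n) then 0 else 1) \<partial>M)"
    proof (rule summable_comparison_test')
      show "summable (\<lambda>n. \<integral>x. h n x \<partial>P i)"
      proof (rule summableI_nonneg_bounded)
        fix m
        have "(\<Sum>n<m. \<integral>x. h n x \<partial>P i) = (\<integral>x. (\<Sum>n<m. h n x) \<partial>P i)"
          using inth by (subst Bochner_Integration.integral_sum) auto
        also have "\<dots> \<le> (\<integral>x. \<phi> x \<partial>P i)"
          using inth int sum_exceedances_le[OF nn] by (intro integral_mono) (auto simp: h_def)
        finally show "(\<Sum>n<m. \<integral>x. h n x \<partial>P i) \<le> (\<integral>x. \<phi> x \<partial>P i)" .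
      qed (simp add: h_def)
      fix n :: nat
      have "(\<integral>\<omega>. indicat_real {i} (J n \<omega>) * (\<integral>x. h n x \<partial>P i) \<partial>M) \<le> (\<integral>\<omega>. (\<integral>x. h n x \<partial>P i) \<partial>M)"
        by (rule integral_mono') (auto simp: indicator_def h_def)
      then show "norm (\<integral>\<omega>. indicat_real {i} (J n \<omega>) * (if \<phi> (\<xi> n \<omega>) \<le> real (Suc n) then 0 else 1) \<partial>M)
          \<le> (\<integral>x. h n x \<partial>P i)"
        using eq[of n] by (subst real_norm_def, subst abs_of_nonneg) (auto simp: prob_space h_def)
    qed
  qed (auto simp: indicator_def)
  ultimately show ?thesis
  proof eventually_elim
    case (elim \<omega>)
    define m where "m = (\<lambda>n. \<integral>x. g n x \<partial>P i)"
    define \<mu> where "\<mu> = (\<integral>x. \<phi> x \<partial>P i)"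
    have "m \<longlonglongrightarrow> \<mu>" unfolding m_def \<mu>_def
    proof (rule integral_dominated_convergence[where w = \<phi>])
      show "AE x in P i. (\<lambda>n. g n x) \<longlonglongrightarrow> \<phi> x"
      proof (rule AE_I2)
        fix x
        obtain n0 where "\<phi> x \<le> real n0" using real_arch_simple by blast
        then have "\<forall>\<^sub>F n in sequentially. g n x = \<phi> x"
          by (intro eventually_sequentiallyI[of n0]) (auto simp: g_def)
        then show "(\<lambda>n. g n x) \<longlonglongrightarrow> \<phi> x" by (rule tendsto_eventually)
      qed
    qed (use g0 g\<phi> int in auto)
    \<comment> \<open>\<open>a\<close> is the error from truncating values, \<open>b\<close> the
      error from truncating means; both are null sequences, so their Cesaro means vanish.\<close>
    define a where "a = (\<lambda>n. indicat_real {i} (J n \<omega>) * (\<phi> (\<xi> n \<omega>) - g n (\<xi> n \<omega>)))"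
    define b where "b = (\<lambda>n. indicat_real {i} (J n \<omega>) * (m n - \<mu>))"
    have "\<forall>\<^sub>F n in sequentially. indicat_real {i} (J n \<omega>) * (if \<phi> (\<xi> n \<omega>) \<le> real (Suc n) then 0 else 1) < 1"
      using order_tendstoD(2)[OF elim(2), of 1] by simp
    then have "\<forall>\<^sub>F n in sequentially. a n = 0"
      by eventually_elim (auto simp: a_def g_def indicator_def split: if_splits)
    then have a: "a \<longlonglongrightarrow> 0" by (rule tendsto_eventually)
    have "(\<lambda>n. m n - \<mu>) \<longlonglongrightarrow> 0" using \<open>m \<longlonglongrightarrow> \<mu>\<close> by (simp add: LIM_zero)
    then have b: "b \<longlonglongrightarrow> 0"
      by (rule Lim_null_comparison[rotated, OF tendsto_rabs_zero]) (auto simp: b_def indicator_def)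
    have "(\<lambda>n. (\<Sum>k<n. indicat_real {i} (J k \<omega>) * (g k (\<xi> k \<omega>) - m k)) / real n
        + (\<Sum>k<n. a k) / real n + (\<Sum>k<n. b k) / real n) \<longlonglongrightarrow> 0 + 0 + 0"
      using elim(1) by (intro tendsto_add LIMSEQ_arith_mean_0[OF a] LIMSEQ_arith_mean_0[OF b]) (simp add: m_def)
    also have "(\<lambda>n. (\<Sum>k<n. indicat_real {i} (J k \<omega>) * (g k (\<xi> k \<omega>) - m k)) / real n
        + (\<Sum>k<n. a k) / real n + (\<Sum>k<n. b k) / real n)
      = (\<lambda>n. (\<Sum>k<n. indicat_real {i} (J k \<omega>) * (\<phi> (\<xi> k \<omega>) - \<mu>)) / real n)"
      unfolding add_divide_distrib[symmetric] sum.distrib[symmetric]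
      by (intro ext arg_cong2[where f = "(/)"] sum.cong) (auto simp: a_def b_def algebra_simps)
    finally show ?case by (simp add: \<mu>_def)
  qed
qed

text \<open>Splitting into positive and negative parts restores the one-sided bound that a signed
  increment may lack.\<close>

lemma strong_law_regime:
  assumes i: "i \<le> l"
  shows "AE \<omega> in M. (\<lambda>n. (\<Sum>k<n. indicator {i} (J k \<omega>) * (\<xi> k \<omega> - mean (P i))) / real n) \<longlonglongrightarrow> 0"
proof -
  interpret Pi: prob_space "P i" using P_prob[OF i] .
  have [measurable_cong]: "sets (P i) = sets borel" by (rule P_sets[OF i])
  define p q :: "real \<Rightarrow> real" where "p = (\<lambda>x. max x 0)" and "q = (\<lambda>x. max (- x) 0)"
  have [measurable]: "p \<in> borel_measurable borel" "q \<in> borel_measurable borel"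
    unfolding p_def q_def by measurable
  have int: "integrable (P i) p" "integrable (P i) q"
    by (rule Bochner_Integration.integrable_bound[OF P_integrable[OF i]]; auto simp: p_def q_def)+
  have pq: "x = p x - q x" for x by (auto simp: p_def q_def)
  have mean: "mean (P i) = (\<integral>x. p x \<partial>P i) - (\<integral>x. q x \<partial>P i)"
    unfolding mean_def using int by (subst pq) simp
  have "AE \<omega> in M. (\<lambda>n. (\<Sum>k<n. indicator {i} (J k \<omega>) * (p (\<xi> k \<omega>) - (\<integral>x. p x \<partial>P i))) / real n) \<longlonglongrightarrow> 0"
    by (rule strong_law_nonneg[OF i _ int(1)]) (auto simp: p_def)
  moreover have "AE \<omega> in M. (\<lambda>n. (\<Sum>k<n. indicator {i} (J k \<omega>) * (q (\<xi> k \<omega>) - (\<integral>x. q x \<partial>P i))) / real n) \<longlonglongrightarrow> 0"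
    by (rule strong_law_nonneg[OF i _ int(2)]) (auto simp: q_def)
  ultimately show ?thesis
  proof eventually_elim
    case (elim \<omega>)
    have "(\<Sum>k<n. indicator {i} (J k \<omega>) * (\<xi> k \<omega> - mean (P i))) / real n
      = (\<Sum>k<n. indicator {i} (J k \<omega>) * (p (\<xi> k \<omega>) - (\<integral>x. p x \<partial>P i))) / real n
      - (\<Sum>k<n. indicator {i} (J k \<omega>) * (q (\<xi> k \<omega>) - (\<integral>x. q x \<partial>P i))) / real n" for n
      unfolding diff_divide_distrib[symmetric] sum_subtractf[symmetric] mean
      by (subst (1) pq) (simp add: algebra_simps)
    then show ?case using tendsto_diff[OF elim] by simp
  qed
qed

end

section \<open>A stay in a single regime\<close>

abbreviation borel_seq :: "(nat \<Rightarrow> real) measure" where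
  "borel_seq \<equiv> \<Pi>\<^sub>M j\<in>UNIV. borel"

text \<open>
  \<open>nx m y\<close> is the regime chosen after \<open>m\<close> jumps made in regime \<open>i\<close>, where \<open>y\<close> lists the
  increments backwards in time, \<open>y 0\<close> being the last one.
\<close>

locale single_regime = prob_space Q
  for Q :: "real measure" +
  fixes i N :: nat and nx :: "nat \<Rightarrow> (nat \<Rightarrow> real) \<Rightarrow> nat" and B :: "real set"
  assumes sets_Q [measurable_cong]: "sets Q = sets borel"
    and nx_measurable [measurable]: "\<And>m. nx m \<in> measurable borel_seq (count_space UNIV)"
    and nx_cong: "\<And>m y y'. (\<And>j. j < m \<Longrightarrow> y j = y' j) \<Longrightarrow> nx m y = nx m y'"
    and nx_young: "\<And>m y. m < N \<Longrightarrow> nx m y = i"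
    and N_pos: "N > 0"
    and B [measurable]: "B \<in> sets borel" and B_pos: "measure Q B > 0"
    and escape: "\<And>m y. N \<le> m \<Longrightarrow> (\<And>j. j < N \<Longrightarrow> y j \<in> B) \<Longrightarrow> nx m y \<noteq> i"
begin

section \<open>Expected reward until the stay ends\<close>

context
  fixes \<rho> :: "nat \<Rightarrow> real"
  assumes \<rho>: "\<And>k. 0 \<le> \<rho> k" "\<And>k. \<rho> k \<le> 1"
begin

text \<open>The integrand of the Poisson equation: the reward for the regime just chosen, plus the
  continuation value \<open>f\<close> while that regime is still \<open>i\<close>.\<close>

definition gain :: "(nat \<Rightarrow> (nat \<Rightarrow> real) \<Rightarrow> real) \<Rightarrow> nat \<Rightarrow> (nat \<Rightarrow> real) \<Rightarrow> real" where
  "gain f m y = \<rho> (nx m y) + (if nx m y = i then f m y else 0)"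

text \<open>Value iteration: the expected reward from at most \<open>n\<close> further choices after
  \<open>m\<close> jumps with reversed increments \<open>y\<close>. Starting from 0 makes it
  increasing in \<open>n\<close>; \<open>case_nat x y\<close> prepends the newest increment.\<close>

primrec iterate :: "nat \<Rightarrow> nat \<Rightarrow> (nat \<Rightarrow> real) \<Rightarrow> real" where
  "iterate 0 = (\<lambda>m y. 0)"
| "iterate (Suc n) = (\<lambda>m y. \<integral>x. gain (iterate n) (Suc m) (case_nat x y) \<partial>Q)"

lemma gain_measurable:
  assumes [measurable]: "f m \<in> borel_measurable borel_seq"
  shows "gain f m \<in> borel_measurable borel_seq"
  unfolding gain_def by measurable

lemma iterate_Suc: "iterate (Suc n) m y = (\<integral>x. gain (iterate n) (Suc m) (case_nat x y) \<partial>Q)"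
  by simp

lemma case_nat_pair_measurable:
  assumes "f \<in> borel_measurable borel_seq"
  shows "(\<lambda>(y, x). f (case_nat x y) :: real) \<in> borel_measurable (borel_seq \<Otimes>\<^sub>M borel)"
proof -
  have "(\<lambda>p. case_nat (snd p) (fst p)) \<in> measurable (borel_seq \<Otimes>\<^sub>M borel) borel_seq"
    by measurable
  from measurable_compose[OF this assms] show ?thesis by (simp add: case_prod_beta')
qed

lemma case_nat_measurable:
  assumes "f \<in> borel_measurable borel_seq"
  shows "(\<lambda>x. f (case_nat x y) :: real) \<in> borel_measurable Q"
proof -
  have "(\<lambda>x. case_nat x y) \<in> measurable Q borel_seq"
    by (intro measurable_case_nat') (auto simp: space_PiM)
  from measurable_compose[OF this assms] show ?thesis .
qed

lemma iterate_measurable: "iterate n m \<in> borel_measurable borel_seq"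
proof (induction n arbitrary: m)
  case (Suc n)
  have "sets (borel_seq \<Otimes>\<^sub>M borel) = sets (borel_seq \<Otimes>\<^sub>M Q)"
    by (intro sets_pair_measure_cong refl sets_Q[symmetric])
  then have "(\<lambda>(y, x). gain (iterate n) (Suc m) (case_nat x y)) \<in> borel_measurable (borel_seq \<Otimes>\<^sub>M Q)"
    using case_nat_pair_measurable[OF gain_measurable[where f = "iterate n" and m = "Suc m", OF Suc]]
      measurable_cong_sets by blast
  then show ?case
    by (simp add: borel_measurable_lebesgue_integral)
qed simp

lemma gain_mono: "f m y \<le> g m y \<Longrightarrow> gain f m y \<le> gain g m y"
  by (auto simp: gain_def)

lemma gain_nonneg: "0 \<le> f m y \<Longrightarrow> 0 \<le> gain f m y"
  using \<rho> by (simp add: gain_def)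

lemma gain_le: "0 \<le> f m y \<Longrightarrow> gain f m y \<le> 1 + f m y"
  using \<rho>(2)[of "nx m y"] by (auto simp: gain_def)

lemma gain_integrable:
  assumes "f (Suc m) \<in> borel_measurable borel_seq" "\<And>y. 0 \<le> f (Suc m) y" "\<And>y. f (Suc m) y \<le> C"
  shows "integrable Q (\<lambda>x. gain f (Suc m) (case_nat x y))"
proof (rule integrable_const_bound)
  have "\<bar>gain f (Suc m) (case_nat x y)\<bar> \<le> 1 + C" for x
    using assms(2,3)[of "case_nat x y"] gain_nonneg[of f "Suc m" "case_nat x y"] gain_le[of f "Suc m" "case_nat x y"]
    by linarith
  then show "AE x in Q. norm (gain f (Suc m) (case_nat x y)) \<le> 1 + C" by simp
qed (rule case_nat_measurable[OF gain_measurable[where f = f and m = "Suc m", OF assms(1)]])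

lemma iterate_nonneg: "0 \<le> iterate n m y"
  by (induction n arbitrary: m y) (auto intro!: Bochner_Integration.integral_nonneg gain_nonneg)

text \<open>A crude bound that secures integrability before the one uniform in \<open>n\<close> is
  available.\<close>

lemma iterate_le_count: "iterate n m y \<le> real n"
proof (induction n arbitrary: m y)
  case (Suc n)
  have "iterate (Suc n) m y \<le> (\<integral>x. 1 + real n \<partial>Q)"
    unfolding iterate.simps
    using Suc iterate_nonneg
    by (intro integral_mono gain_integrable[where C = "real n"] iterate_measurable)
      (auto intro: order_trans[OF gain_le])
  then show ?case by (simp add: prob_space)
qed simp

lemma iterate_gain_integrable: "integrable Q (\<lambda>x. gain (iterate n) (Suc m) (case_nat x y))"
  by (intro gain_integrable[where C = "real n"] iterate_measurable iterate_nonneg iterate_le_count)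

lemma iterate_Suc_ge: "iterate n m y \<le> iterate (Suc n) m y"
proof (induction n arbitrary: m y)
  case (Suc n)
  show ?case unfolding iterate_Suc[of n m y] iterate_Suc[of "Suc n" m y]
    by (intro integral_mono iterate_gain_integrable gain_mono Suc)
qed (use iterate_nonneg[of "Suc 0"] in simp)

text \<open>The mean waiting time for a run of \<open>j\<close> successes in independent trials with
  success probability \<open>measure Q B\<close>. A run of \<open>j\<close> is followed by one
  trial, whose failure restarts the count; solving for the waiting time gives the quotient.\<close>

primrec deficit :: "nat \<Rightarrow> real" where
  "deficit 0 = 0"
| "deficit (Suc j) = (1 + deficit j) / measure Q B"

lemma deficit_mono: "j \<le> k \<Longrightarrow> deficit j \<le> deficit k"
proof (induction rule: dec_induct)
  case (step n)
  have nn: "0 \<le> deficit n" by (induction n) auto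
  have "deficit n \<le> 1 + deficit n" by simp
  also have "\<dots> \<le> (1 + deficit n) / measure Q B"
    using nn B_pos prob_le_1[of B] by (subst pos_le_divide_eq) (auto intro: mult_left_le)
  finally show ?case using step by simp
qed simp

text \<open>
  If the last \<open>j\<close> increments lie in \<open>B\<close>, then \<open>N - j\<close> further ones in \<open>B\<close> end the stay in the
  regime; \<open>deficit N - deficit j\<close> is the expected time until \<open>N\<close> increments in a row lie in
  \<open>B\<close>, and it bounds the expected remaining time.
\<close>

lemma killed_iterate_le:
  assumes "j \<le> m" "j \<le> N" "\<And>k. k < j \<Longrightarrow> y k \<in> B"
  shows "(if nx m y = i then iterate n m y else 0) \<le> deficit N - deficit j"
  using assms
proof (induction n arbitrary: j m y)
  case 0
  then show ?case using deficit_mono[of j N] by simp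
next
  case (Suc n)
  show ?case
  proof (cases "j = N")
    case True
    then have "nx m y \<noteq> i" using Suc.prems by (intro escape) auto
    then show ?thesis using True by simp
  next
    case False
    then have j: "j < N" using Suc.prems by simp
    define b where "b = measure Q B"
    have b: "b > 0" "b * deficit (Suc j) = 1 + deficit j" using B_pos by (auto simp: b_def)
    \<comment> \<open>A success lengthens the run to \<open>Suc j\<close>, a failure resets it to 0,
      and the choice itself pays at most 1. Integration produces \<open>b * deficit (Suc j)\<close>,
      which the recursion turns into \<open>1 + deficit j\<close>.\<close>
    have "iterate (Suc n) m y \<le> (\<integral>x. 1 + deficit N - indicat_real B x * deficit (Suc j) \<partial>Q)"
      unfolding iterate.simps
    proof (rule integral_mono[OF iterate_gain_integrable])
      show "integrable Q (\<lambda>x. 1 + deficit N - indicat_real B x * deficit (Suc j))"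
        by (intro Bochner_Integration.integrable_diff integrable_mult_left integrable_const)
          (simp add: integrable_real_indicator emeasure_eq_measure)
      fix x
      show "gain (iterate n) (Suc m) (case_nat x y) \<le> 1 + deficit N - indicat_real B x * deficit (Suc j)"
      proof (cases "x \<in> B")
        case True
        have "(if nx (Suc m) (case_nat x y) = i then iterate n (Suc m) (case_nat x y) else 0) \<le> deficit N - deficit (Suc j)"
          using Suc.prems j True by (intro Suc.IH) (auto split: nat.split)
        then show ?thesis using True \<rho>(2)[of "nx (Suc m) (case_nat x y)"]
          unfolding gain_def by simp
      next
        case False
        have "(if nx (Suc m) (case_nat x y) = i then iterate n (Suc m) (case_nat x y) else 0) \<le> deficit N - deficit 0"
          by (intro Suc.IH) auto
        then show ?thesis using False \<rho>(2)[of "nx (Suc m) (case_nat x y)"]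
          unfolding gain_def by simp
      qed
    qed
    also have "\<dots> = 1 + deficit N - b * deficit (Suc j)"
      by (subst Bochner_Integration.integral_diff)
        (auto simp: prob_space b_def integrable_real_indicator emeasure_eq_measure simp del: deficit.simps)
    also have "\<dots> = deficit N - deficit j" using b by simp
    finally show ?thesis using deficit_mono[of j N] j by auto
  qed
qed

text \<open>For \<open>n > 0\<close> the value contains one further jump whether or not the rule
  selects \<open>i\<close> at the given state. That jump pays at most 1, and afterwards the estimate
  for an empty run applies.\<close>

lemma iterate_le: "iterate n m y \<le> 1 + deficit N"
proof (cases n)
  case 0
  then show ?thesis using deficit_mono[of 0 N] by simp
next
  case (Suc k)
  have "iterate (Suc k) m y \<le> (\<integral>x. 1 + deficit N \<partial>Q)"
    unfolding iterate.simps
  proof (rule integral_mono[OF iterate_gain_integrable])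
    fix x
    have "(if nx (Suc m) (case_nat x y) = i then iterate k (Suc m) (case_nat x y) else 0) \<le> deficit N - deficit 0"
      by (rule killed_iterate_le) auto
    then show "gain (iterate k) (Suc m) (case_nat x y) \<le> 1 + deficit N"
      using \<rho>(2)[of "nx (Suc m) (case_nat x y)"] unfolding gain_def by simp
  qed simp
  then show ?thesis using Suc by (simp add: prob_space)
qed

definition total :: "nat \<Rightarrow> (nat \<Rightarrow> real) \<Rightarrow> real" where
  "total m y = (SUP n. iterate n m y)"

lemma iterate_LIMSEQ: "(\<lambda>n. iterate n m y) \<longlonglongrightarrow> total m y"
  unfolding total_def
  by (intro LIMSEQ_incseq_SUP incseq_SucI iterate_Suc_ge bdd_aboveI[where M = "1 + deficit N"])
    (auto intro: iterate_le)

lemma total_nonneg: "0 \<le> total m y"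
  by (rule LIMSEQ_le_const[OF iterate_LIMSEQ]) (auto intro: iterate_nonneg)

lemma total_le: "total m y \<le> 1 + deficit N"
  by (rule LIMSEQ_le_const2[OF iterate_LIMSEQ]) (auto intro: iterate_le)

lemma total_measurable: "total m \<in> borel_measurable borel_seq"
  by (rule borel_measurable_LIMSEQ_real[OF iterate_LIMSEQ iterate_measurable])

lemma total_gain_integrable: "integrable Q (\<lambda>x. gain total (Suc m) (case_nat x y))"
  by (intro gain_integrable[where C = "1 + deficit N"] total_measurable total_nonneg total_le)

text \<open>The recursion of \<open>iterate\<close> passes to the limit under the integral, the
  bound uniform in \<open>n\<close> providing the dominating constant.\<close>

lemma total_eq: "total m y = (\<integral>x. gain total (Suc m) (case_nat x y) \<partial>Q)"
proof (rule LIMSEQ_unique)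
  show "(\<lambda>n. iterate (Suc n) m y) \<longlonglongrightarrow> total m y"
    by (rule LIMSEQ_Suc[OF iterate_LIMSEQ])
  show "(\<lambda>n. iterate (Suc n) m y) \<longlonglongrightarrow> (\<integral>x. gain total (Suc m) (case_nat x y) \<partial>Q)"
    unfolding iterate.simps
  proof (rule integral_dominated_convergence[where w = "\<lambda>_. 1 + (1 + deficit N)"])
    show "AE x in Q. (\<lambda>n. gain (iterate n) (Suc m) (case_nat x y)) \<longlonglongrightarrow> gain total (Suc m) (case_nat x y)"
    proof (rule AE_I2)
      fix x
      show "(\<lambda>n. gain (iterate n) (Suc m) (case_nat x y)) \<longlonglongrightarrow> gain total (Suc m) (case_nat x y)"
        using tendsto_add[OF tendsto_const iterate_LIMSEQ[of "Suc m" "case_nat x y"]]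
        by (cases "nx (Suc m) (case_nat x y) = i") (simp_all add: gain_def)
    qed
    fix n
    have "\<bar>gain (iterate n) (Suc m) z\<bar> \<le> 1 + (1 + deficit N)" for z
      using iterate_nonneg[of n "Suc m" z] iterate_le[of n "Suc m" z]
        gain_nonneg[of "iterate n" "Suc m" z] gain_le[of "iterate n" "Suc m" z] by linarith
    then show "AE x in Q. norm (gain (iterate n) (Suc m) (case_nat x y)) \<le> 1 + (1 + deficit N)" by simp
  qed (auto intro: case_nat_measurable gain_measurable iterate_measurable total_measurable)
qed

text \<open>After \<open>m\<close> jumps of a stay the rule has seen \<open>m\<close> increments.
  For \<open>m = 0\<close> the value at entry is thus a constant, whatever happened before.\<close>

lemma total_cong:
  assumes "\<And>j. j < m \<Longrightarrow> y j = y' j"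
  shows "total m y = total m y'"
proof -
  have "iterate n m y = iterate n m y'" for n
    using assms
  proof (induction n arbitrary: m y y')
    case (Suc n)
    have "gain (iterate n) (Suc m) (case_nat x y) = gain (iterate n) (Suc m) (case_nat x y')" for x
    proof -
      have eq: "case_nat x y j = case_nat x y' j" if "j < Suc m" for j
        using that Suc.prems by (cases j) auto
      show ?thesis unfolding gain_def using nx_cong[OF eq] Suc.IH[OF eq] by simp
    qed
    then show ?case by simp
  qed simp
  then show ?thesis by (simp add: total_def)
qed

text \<open>A stay begins with \<open>N\<close> increments in \<open>A\<close> with probability
  \<open>measure Q A\<close> to the power \<open>N\<close>. Below age \<open>N\<close> the rule
  cannot end the stay, and at age \<open>N\<close> such a run pays 1.\<close>

lemma total_pos:
  assumes A [measurable]: "A \<in> sets borel" and pos: "measure Q A > 0"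
    and win: "\<And>m y. N \<le> m \<Longrightarrow> (\<And>j. j < N \<Longrightarrow> y j \<in> A) \<Longrightarrow> \<rho> (nx m y) = 1"
  shows "total 0 y > 0"
proof -
  define a where "a = measure Q A"
  \<comment> \<open>Induction on the number of missing jumps: for \<open>d = 0\<close> the next jump
    already brings the age to \<open>N\<close>, hence the exponent \<open>Suc d\<close>.\<close>
  have "a ^ Suc d \<le> total m y" if "m + d = N - 1" "\<And>j. j < m \<Longrightarrow> y j \<in> A" for d m y
    using that
  proof (induction d arbitrary: m y)
    case 0
    have "measure Q A = (\<integral>x. indicat_real A x \<partial>Q)" by (simp add: sets_Q)
    also have "\<dots> \<le> (\<integral>x. gain total (Suc m) (case_nat x y) \<partial>Q)"
    proof (rule integral_mono[OF _ total_gain_integrable])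
      show "integrable Q (indicat_real A)" by (simp add: integrable_real_indicator emeasure_eq_measure)
      fix x
      have "1 \<le> gain total (Suc m) (case_nat x y)" if "x \<in> A"
      proof -
        have "\<rho> (nx (Suc m) (case_nat x y)) = 1"
          using 0 N_pos that by (intro win) (auto split: nat.split)
        then show ?thesis using total_nonneg by (simp add: gain_def)
      qed
      then show "indicat_real A x \<le> gain total (Suc m) (case_nat x y)"
        using gain_nonneg[of total, OF total_nonneg] by (auto simp: indicator_def)
    qed
    finally show ?case by (simp add: total_eq[of m y] a_def)
  next
    case (Suc d)
    have "a * a ^ Suc d = (\<integral>x. indicat_real A x * a ^ Suc d \<partial>Q)" by (simp add: sets_Q a_def)
    also have "\<dots> \<le> (\<integral>x. gain total (Suc m) (case_nat x y) \<partial>Q)"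
    proof (rule integral_mono[OF _ total_gain_integrable])
      show "integrable Q (\<lambda>x. indicat_real A x * a ^ Suc d)"
        by (intro integrable_mult_left) (simp add: integrable_real_indicator emeasure_eq_measure)
      fix x
      have "a ^ Suc d \<le> gain total (Suc m) (case_nat x y)" if "x \<in> A"
      proof -
        have "a ^ Suc d \<le> total (Suc m) (case_nat x y)"
          using Suc.prems that by (intro Suc.IH) (auto split: nat.split)
        moreover have "nx (Suc m) (case_nat x y) = i"
          using Suc.prems by (intro nx_young) simp
        ultimately show ?thesis using \<rho>(1)[of i] by (simp add: gain_def)
      qed
      then show "indicat_real A x * a ^ Suc d \<le> gain total (Suc m) (case_nat x y)"
        using gain_nonneg[of total, OF total_nonneg] by (auto simp: indicator_def)
    qed
    finally show ?case by (simp add: total_eq[of m y])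
  qed
  from this[of 0 "N - 1" y] have "a ^ Suc (N - 1) \<le> total 0 y" by simp
  moreover have "0 < a ^ Suc (N - 1)" using pos by (simp add: a_def)
  ultimately show ?thesis by linarith
qed

end
end

section \<open>Frequencies of the regimes and the speed\<close>

text \<open>No convergence of the entry frequencies \<open>e i\<close> is assumed. Balance expresses
  each of them asymptotically by \<open>e 0\<close> with the product weights of a birth-and-death
  chain; then the total mass 1 pins down \<open>e 0\<close>.\<close>

lemma balance_limits:
  fixes a e :: "nat \<Rightarrow> nat \<Rightarrow> real" and m u d :: "nat \<Rightarrow> real"
  assumes time: "\<And>i. i \<le> l \<Longrightarrow> (\<lambda>n. a i n - m i * e i n) \<longlonglongrightarrow> 0"
    and balance: "\<And>i. i < l \<Longrightarrow> (\<lambda>n. u i * e i n - d (Suc i) * e (Suc i) n) \<longlonglongrightarrow> 0"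
    and total: "(\<lambda>n. \<Sum>i\<le>l. a i n) \<longlonglongrightarrow> 1"
    and m: "\<And>i. i \<le> l \<Longrightarrow> m i > 0"
    and u: "\<And>i. i < l \<Longrightarrow> u i > 0" and d: "\<And>i. i < l \<Longrightarrow> d (Suc i) > 0"
    and i: "i \<le> l"
  shows "a i \<longlonglongrightarrow> m i * (\<Prod>j<i. u j / d (Suc j)) / (\<Sum>i\<le>l. m i * (\<Prod>j<i. u j / d (Suc j)))"
proof -
  define w where "w = (\<lambda>i. \<Prod>j<i. u j / d (Suc j))"
  define S where "S = (\<Sum>i\<le>l. m i * w i)"
  have w: "w i > 0" if "i \<le> l" for i
    unfolding w_def using that u d by (intro prod_pos) auto
  have S: "S > 0" unfolding S_def using m w by (intro sum_pos) auto
  have e: "(\<lambda>n. e i n - w i * e 0 n) \<longlonglongrightarrow> 0" if "i \<le> l" for i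
    using that
  proof (induction i)
    case (Suc i)
    then have i: "i < l" by simp
    have "(\<lambda>n. u i / d (Suc i) * (e i n - w i * e 0 n) - (u i * e i n - d (Suc i) * e (Suc i) n) / d (Suc i))
        \<longlonglongrightarrow> u i / d (Suc i) * 0 - 0 / d (Suc i)"
      using Suc balance[OF i] d[OF i] by (intro tendsto_intros) auto
    moreover have "u i / d (Suc i) * (e i n - w i * e 0 n) - (u i * e i n - d (Suc i) * e (Suc i) n) / d (Suc i)
        = e (Suc i) n - w (Suc i) * e 0 n" for n
      using d[OF i] by (simp add: w_def field_simps)
    ultimately show ?case by simp
  qed (simp add: w_def)
  have a: "(\<lambda>n. a i n - m i * w i * e 0 n) \<longlonglongrightarrow> 0" if "i \<le> l" for i
  proof -
    have "(\<lambda>n. (a i n - m i * e i n) + m i * (e i n - w i * e 0 n)) \<longlonglongrightarrow> 0 + m i * 0"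
      using that by (intro tendsto_intros time e)
    then show ?thesis by (simp add: algebra_simps)
  qed
  have "(\<lambda>n. (\<Sum>i\<le>l. a i n) - (\<Sum>i\<le>l. a i n - m i * w i * e 0 n)) \<longlonglongrightarrow> 1 - (\<Sum>i\<le>l. 0)"
    by (intro tendsto_intros total a) simp
  then have "(\<lambda>n. S * e 0 n / S) \<longlonglongrightarrow> 1 / S"
    using S by (intro tendsto_divide) (auto simp: sum_subtractf S_def sum_distrib_right)
  then have e0: "(\<lambda>n. e 0 n) \<longlonglongrightarrow> 1 / S" using S by simp
  have "(\<lambda>n. (a i n - m i * w i * e 0 n) + m i * w i * e 0 n) \<longlonglongrightarrow> 0 + m i * w i * (1 / S)"
    by (intro tendsto_intros a i e0)
  then show ?thesis
    by (simp add: w_def S_def)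
qed

section \<open>The switching rule under Assumptions A and B\<close>

lemma next_regime_cases:
  "next_regime l r i a = i - 1 \<or> next_regime l r i a = i \<or> next_regime l r i a = Suc i"
  by (simp add: next_regime_def)

lemma next_regime_le: "i \<le> l \<Longrightarrow> next_regime l r i a \<le> l"
  by (auto simp: next_regime_def threshold_def)

lemma next_regime_measurable [measurable]: "next_regime l r i \<in> measurable borel (count_space UNIV)"
  unfolding next_regime_def by measurable

locale regime_walk_AB = regime_walk +
  assumes A: "assumption_A l P r" and B: "assumption_B l P r" and l_le_N: "l \<le> N"
begin

text \<open>An average inherits bounds on its terms, so \<open>N\<close> increments in one of these
  sets force the corresponding switch. Assumption B gives them positive mass wherever a switch in
  that direction exists.\<close>

definition up :: "nat \<Rightarrow> real set" where "up i = {x. threshold l r (Suc i) \<le> ereal x}"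
definition down :: "nat \<Rightarrow> real set" where "down i = {x. ereal x < threshold l r i}"

lemma up_down_borel [measurable]: "up i \<in> sets borel" "down i \<in> sets borel"
  unfolding up_def down_def by measurable

lemma l_pos: "l > 0"
proof (rule ccontr)
  assume "\<not> l > 0"
  then have "measure (P 0) {x. threshold l r 1 \<le> ereal x} = 0" by (simp add: threshold_def)
  then show False using B by (simp add: assumption_B_def)
qed

lemma N_pos: "N > 0"
  using l_pos l_le_N by simp

lemma up_pos: "i < l \<Longrightarrow> measure (P i) (up i) > 0"
  using B by (cases "i = 0") (auto simp: assumption_B_def up_def)

lemma down_pos: "0 < i \<Longrightarrow> i \<le> l \<Longrightarrow> measure (P i) (down i) > 0"
  using B by (cases "i = l") (auto simp: assumption_B_def down_def)

text \<open>The mean of an inner regime separates its thresholds. The order matters because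
  \<open>next_regime\<close> tests the lower threshold first, and this test must fail when the upper
  one is passed.\<close>

lemma threshold_mono:
  assumes "i \<le> l"
  shows "threshold l r i \<le> threshold l r (Suc i)"
proof (cases "i = 0 \<or> i = l")
  case True
  then show ?thesis by (auto simp: threshold_def)
next
  case False
  then have "i \<in> {1..l - 1}" using assms by auto
  then have "threshold l r i < mean (P i)" "mean (P i) < threshold l r (Suc i)"
    using A unfolding assumption_A_def by blast+
  then show ?thesis by simp
qed

text \<open>The delay is expressed by the number \<open>m\<close> of jumps since entry rather than
  by comparing regimes \<open>N\<close> steps apart. As \<open>y\<close> runs backwards, its first
  \<open>N\<close> entries are the averaging window.\<close>

definition nxt :: "nat \<Rightarrow> nat \<Rightarrow> (nat \<Rightarrow> real) \<Rightarrow> nat" where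
  "nxt i m y = (if m < N then i else next_regime l r i ((\<Sum>j<N. y j) / real N))"

lemma nxt_up:
  assumes "i < l" "N \<le> m" "\<And>j. j < N \<Longrightarrow> y j \<in> up i"
  shows "nxt i m y = Suc i"
proof -
  have "(\<Sum>j<N. r (Suc i)) \<le> (\<Sum>j<N. y j)"
    using assms by (intro sum_mono) (auto simp: up_def threshold_def)
  then have "threshold l r (Suc i) \<le> ereal ((\<Sum>j<N. y j) / real N)"
    using N_pos assms(1) by (simp add: threshold_def field_simps)
  moreover from this have "\<not> ereal ((\<Sum>j<N. y j) / real N) < threshold l r i"
    using order_trans[OF threshold_mono[of i]] assms(1) by (simp add: not_less)
  ultimately show ?thesis using assms(2) by (simp add: nxt_def next_regime_def)
qed

lemma nxt_down:
  assumes "0 < i" "i \<le> l" "N \<le> m" "\<And>j. j < N \<Longrightarrow> y j \<in> down i"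
  shows "nxt i m y = i - 1"
proof -
  have "(\<Sum>j<N. y j) < (\<Sum>j<N. r i)"
    using assms N_pos by (intro sum_strict_mono) (auto simp: down_def threshold_def)
  then have "ereal ((\<Sum>j<N. y j) / real N) < threshold l r i"
    using N_pos assms(1,2) by (simp add: threshold_def field_simps)
  then show ?thesis using assms(3) by (simp add: nxt_def next_regime_def)
qed

lemma nxt_measurable: "nxt i m \<in> measurable borel_seq (count_space UNIV)"
  unfolding nxt_def by measurable

lemma nxt_cong: "(\<And>j. j < m \<Longrightarrow> y j = y' j) \<Longrightarrow> nxt i m y = nxt i m y'"
  unfolding nxt_def by (auto intro!: arg_cong[where f = "\<lambda>s. next_regime l r i (s / real N)"] sum.cong)

text \<open>Some set of increments must force an exit. Below \<open>l\<close> an upward exit serves;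
  the top regime has no upper threshold, so it is left downwards.\<close>

lemma single_regime_P:
  assumes "i \<le> l"
  shows "single_regime (P i) i N (nxt i) (if i < l then up i else down i)"
proof -
  interpret Pi: prob_space "P i" using P_prob[OF assms] .
  show ?thesis
  proof
    show "sets (P i) = sets borel" by (rule P_sets[OF assms])
    show "measure (P i) (if i < l then up i else down i) > 0"
      using up_pos[of i] down_pos[of i] assms l_pos by auto
    show "nxt i m \<in> measurable borel_seq (count_space UNIV)" for m by (rule nxt_measurable)
    show "nxt i m y = nxt i m y'" if "\<And>j. j < m \<Longrightarrow> y j = y' j" for m y y'
      using that by (rule nxt_cong)
    show "nxt i m y \<noteq> i" if "N \<le> m" "\<And>j. j < N \<Longrightarrow> y j \<in> (if i < l then up i else down i)" for m y
      using that nxt_up[of i m y] nxt_down[of i m y] assms l_pos by (cases "i < l") auto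
  qed (auto simp: nxt_def N_pos)
qed

text \<open>The jump leaving time \<open>n\<close> is not yet counted, so the rule for time
  \<open>Suc n\<close> sees \<open>Suc (age n \<omega>)\<close> jumps.\<close>

primrec age :: "nat \<Rightarrow> 'a \<Rightarrow> nat" where
  "age 0 \<omega> = 0"
| "age (Suc n) \<omega> = (if J (Suc n) \<omega> = J n \<omega> then Suc (age n \<omega>) else 0)"

text \<open>Increments listed backwards from time \<open>n\<close>. The default 0 pads the time
  before the origin; a window consulted by the rule never reaches it, since the age is at most
  \<open>n\<close>.\<close>

definition recent :: "nat \<Rightarrow> 'a \<Rightarrow> nat \<Rightarrow> real" where
  "recent n \<omega> j = (if j < n then \<xi> (n - Suc j) \<omega> else 0)"

lemma recent_Suc: "recent (Suc n) \<omega> = case_nat (\<xi> n \<omega>) (recent n \<omega>)"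
  by (auto simp: recent_def fun_eq_iff split: nat.split)

lemma sum_recent: "k \<le> n \<Longrightarrow> (\<Sum>j<k. recent n \<omega> j) = X n \<omega> - X (n - k) \<omega>"
proof (induction k)
  case (Suc k)
  then have "Suc (n - Suc k) = n - k" by simp
  then show ?case using Suc by (simp add: recent_def)
qed simp

lemma age_le: "age n \<omega> \<le> n"
  by (induction n) auto

lemma regime_during_age: "k \<le> age n \<omega> \<Longrightarrow> J (n - k) \<omega> = J n \<omega>"
proof (induction n arbitrary: k)
  case (Suc n)
  then show ?case by (cases k) (auto split: if_splits)
qed simp

lemma regime_before_age: "age n \<omega> < n \<Longrightarrow> J (n - Suc (age n \<omega>)) \<omega> \<noteq> J n \<omega>"
  by (induction n) (auto split: if_splits)

lemma regime_kept:
  assumes "\<omega> \<in> space M" "N \<le> Suc t" "J (Suc t - N) \<omega> \<noteq> J t \<omega>"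
  shows "J (Suc t) \<omega> = J t \<omega>"
  using J_step[OF assms(1,2)] assms(3) by simp

text \<open>\<open>J_step\<close> compares just two regimes, which might agree although a change
  lies between them. Strong induction excludes this: the preceding stay had at least
  \<open>N\<close> jumps, so at a smaller age the regime found \<open>N\<close> steps back is the
  preceding one, and no switch occurs.\<close>

lemma age_at_switch:
  assumes \<omega>: "\<omega> \<in> space M" and "J (Suc t) \<omega> \<noteq> J t \<omega>"
  shows "N \<le> Suc (age t \<omega>)"
  using assms(2)
proof (induction t rule: less_induct)
  case (less t)
  have N: "N \<le> Suc t"
  proof (rule ccontr)
    assume "\<not> N \<le> Suc t"
    then have "J (Suc t) \<omega> = start" "J t \<omega> = start" using \<omega> by (auto intro!: J_start)
    then show False using less.prems by simp
  qed
  have same: "J (Suc t - N) \<omega> = J t \<omega>" using regime_kept[OF \<omega> N] less.prems by blast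
  show ?case
  proof (rule ccontr)
    assume young: "\<not> N \<le> Suc (age t \<omega>)"
    then have "age t \<omega> < t" using N by simp
    define s where "s = t - Suc (age t \<omega>)"
    have s: "s < t" "Suc s = t - age t \<omega>" using \<open>age t \<omega> < t\<close> by (auto simp: s_def)
    have js: "J s \<omega> \<noteq> J t \<omega>" unfolding s_def by (rule regime_before_age) fact
    moreover have "J (Suc s) \<omega> = J t \<omega>" unfolding s(2) by (rule regime_during_age) simp
    ultimately have "N \<le> Suc (age s \<omega>)" using s by (intro less.IH) auto
    then have "J (s - (s - (Suc t - N))) \<omega> = J s \<omega>"
      using young s N by (intro regime_during_age) (auto simp: s_def)
    moreover have "s - (s - (Suc t - N)) = Suc t - N" using young N by (auto simp: s_def)
    ultimately show False using same js by simp
  qed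
qed

text \<open>Current regime, age and recent increments form a sufficient state. A young stay cannot
  end; in an older one the regime \<open>N\<close> steps back is the current one, and the window
  average decides.\<close>

lemma J_Suc:
  assumes \<omega>: "\<omega> \<in> space M"
  shows "J (Suc n) \<omega> = nxt (J n \<omega>) (Suc (age n \<omega>)) (recent (Suc n) \<omega>)"
proof (cases "Suc (age n \<omega>) < N")
  case True
  then have "J (Suc n) \<omega> = J n \<omega>" using age_at_switch[OF \<omega>, of n] by fastforce
  then show ?thesis using True by (simp add: nxt_def)
next
  case False
  then have N: "N \<le> Suc n" using age_le[of n \<omega>] by simp
  have "J (n - (N - 1)) \<omega> = J n \<omega>" using False by (intro regime_during_age) simp
  moreover have "n - (N - 1) = Suc n - N" using N_pos by simp
  ultimately have "J (Suc n - N) \<omega> = J n \<omega>" by simp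
  then show ?thesis using J_step[OF \<omega> N] False sum_recent[OF N, of \<omega>] by (simp add: nxt_def)
qed

lemma J_Suc_cases:
  assumes "\<omega> \<in> space M"
  shows "J (Suc n) \<omega> = J n \<omega> - 1 \<or> J (Suc n) \<omega> = J n \<omega> \<or> J (Suc n) \<omega> = Suc (J n \<omega>)"
  using J_Suc[OF assms, of n] next_regime_cases[of l r "J n \<omega>"] by (auto simp: nxt_def)

lemma J_le:
  assumes "\<omega> \<in> space M"
  shows "J n \<omega> \<le> l"
proof (induction n)
  case 0
  then show ?case using J_start[OF assms N_pos] start_le by simp
next
  case (Suc n)
  then show ?case using J_Suc[OF assms, of n] next_regime_le[OF Suc] by (simp add: nxt_def)
qed

section \<open>Adaptedness of age and window\<close>

lemma age_filt: "n \<le> m \<Longrightarrow> age n \<in> measurable (filt m) (count_space UNIV)"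
proof (induction n)
  case (Suc n)
  have [measurable]: "J (Suc n) \<in> measurable (filt m) (count_space UNIV)"
    "J n \<in> measurable (filt m) (count_space UNIV)" "age n \<in> measurable (filt m) (count_space UNIV)"
    using Suc by (auto intro: J_filt)
  have "(\<lambda>\<omega>. Suc (age n \<omega>)) \<in> measurable (filt m) (count_space UNIV)"
    by (rule measurable_compose[of "age n" _ "count_space UNIV" Suc]) simp_all
  moreover have "Measurable.pred (filt m) (\<lambda>\<omega>. \<exists>k. J n \<omega> = k \<and> J (Suc n) \<omega> = k)" by measurable
  then have "Measurable.pred (filt m) (\<lambda>\<omega>. J (Suc n) \<omega> = J n \<omega>)" by (rule back_subst[of "Measurable.pred (filt m)"]) auto
  ultimately show ?case unfolding age.simps by (intro measurable_If measurable_const) (auto simp: pred_def)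
qed (simp add: fun_eq_iff[of "age 0" "\<lambda>_. 0", THEN iffD2])

lemma recent_filt: "recent n \<in> measurable (filt n) borel_seq"
proof (rule measurable_PiM_single')
  fix j
  show "(\<lambda>\<omega>. recent n \<omega> j) \<in> borel_measurable (filt n)"
  proof (cases "j < n")
    case True
    then have "X (Suc (n - Suc j)) \<in> borel_measurable (filt n)" "X (n - Suc j) \<in> borel_measurable (filt n)"
      by (auto intro: X_filt)
    then show ?thesis using True by (simp add: recent_def)
  qed (simp add: recent_def)
qed simp

text \<open>The stay running at time 0 is not counted; this affects the count by at most 1, which
  disappears after division by \<open>n\<close>.\<close>

definition entries :: "nat \<Rightarrow> 'a \<Rightarrow> nat \<Rightarrow> real" where
  "entries i \<omega> n = (\<Sum>k<n. of_bool (J k \<omega> \<noteq> i \<and> J (Suc k) \<omega> = i))"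

text \<open>The error is compared with \<open>n\<close>, not with the number of entries, so nothing
  about recurrence of \<open>i\<close> is presupposed. Letting \<open>\<rho>\<close> see the regime
  after the jump covers durations and crossings alike.\<close>

definition reward_rate :: "nat \<Rightarrow> (nat \<Rightarrow> real) \<Rightarrow> real \<Rightarrow> bool" where
  "reward_rate i \<rho> c \<longleftrightarrow> (AE \<omega> in M. (\<lambda>n.
     ((\<Sum>k<n. of_bool (J k \<omega> = i) * \<rho> (J (Suc k) \<omega>)) - c * entries i \<omega> n) / real n) \<longlonglongrightarrow> 0)"

text \<open>
  The expected value \<open>T\<close> of the remaining rewards until the regime is left solves a Poisson
  equation, so the rewards minus the increments of \<open>T\<close> along the path are martingale
  differences. The sum of these increments telescopes, except that each entry restarts \<open>T\<close>
  at the constant value \<open>c\<close>.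
\<close>

lemma rewards_proportional_to_entries:
  fixes \<rho> :: "nat \<Rightarrow> real"
  assumes i: "i \<le> l" and \<rho>: "\<And>k. 0 \<le> \<rho> k" "\<And>k. \<rho> k \<le> 1"
    and S: "S \<in> sets borel" "measure (P i) S > 0"
    and win: "\<And>m y. N \<le> m \<Longrightarrow> (\<And>j. j < N \<Longrightarrow> y j \<in> S) \<Longrightarrow> \<rho> (nxt i m y) = 1"
  shows "\<exists>c>0. reward_rate i \<rho> c"
proof -
  interpret sr: single_regime "P i" i N "nxt i" "if i < l then up i else down i"
    by (rule single_regime_P[OF i])
  define T where "T = sr.total \<rho>"
  define G where "G = sr.gain \<rho> T"
  define K where "K = 1 + sr.deficit N"
  define c where "c = T 0 (\<lambda>_. 0)"
  have T0: "0 \<le> T m y" and TK: "T m y \<le> K" for m y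
    unfolding T_def K_def by (rule sr.total_nonneg[where \<rho> = \<rho>, OF \<rho>], rule sr.total_le[OF \<rho>])
  have Tc: "T 0 y = c" for y
    unfolding c_def T_def by (rule sr.total_cong[where \<rho> = \<rho>, OF \<rho>]) simp
  have "c > 0" unfolding c_def T_def
    by (rule sr.total_pos[where \<rho> = \<rho> and A = S, OF \<rho> S win])
  have Teq: "T m y = (\<integral>x. G (Suc m) (case_nat x y) \<partial>P i)" for m y
    unfolding T_def G_def by (rule sr.total_eq[where \<rho> = \<rho>, OF \<rho>])
  have Gdef: "G m y = \<rho> (nxt i m y) + (if nxt i m y = i then T m y else 0)" for m y
    unfolding G_def by (rule sr.gain_def[where \<rho> = \<rho>, OF \<rho>])
  have Gmeas: "G m \<in> borel_measurable borel_seq" for m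
    unfolding G_def T_def by (rule sr.gain_measurable[where \<rho> = \<rho>, OF \<rho>]) (rule sr.total_measurable[OF \<rho>])
  \<comment> \<open>The past enters through age and window; \<open>x\<close> stands for the coming
    increment.\<close>
  define g where "g = (\<lambda>k \<omega> x. G (Suc (age k \<omega>)) (case_nat x (recent k \<omega>)))"
  have gmeas: "case_prod (g k) \<in> borel_measurable (filt k \<Otimes>\<^sub>M borel)" for k
  proof -
    have "(\<lambda>p. G (Suc m) (case_nat (snd p) (recent k (fst p)))) \<in> borel_measurable (filt k \<Otimes>\<^sub>M borel)" for m
      by (rule measurable_compose[OF measurable_case_nat' Gmeas])
        (auto intro: measurable_compose[OF measurable_fst recent_filt])
    \<comment> \<open>The age has countably many values, so measurability at each fixed age
      suffices.\<close>
    then have "(\<lambda>p. G (Suc (age k (fst p))) (case_nat (snd p) (recent k (fst p)))) \<in> borel_measurable (filt k \<Otimes>\<^sub>M borel)"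
      by (rule measurable_compose_countable) (rule measurable_compose[OF measurable_fst age_filt[OF order_refl]])
    then show ?thesis by (simp add: g_def case_prod_beta')
  qed
  have gbound: "\<bar>g k \<omega> x\<bar> \<le> 1 + K" for k \<omega> x
  proof -
    have "\<bar>G m y\<bar> \<le> 1 + K" for m y
      using T0[of m y] TK[of m y] \<rho>[of "nxt i m y"] unfolding Gdef by auto
    then show ?thesis by (simp add: g_def)
  qed
  have "AE \<omega> in M. (\<lambda>n. (\<Sum>k<n. indicator {i} (J k \<omega>) *
           (g k \<omega> (\<xi> k \<omega>) - (\<integral>x. g k \<omega> x \<partial>P i))) / real n) \<longlonglongrightarrow> 0"
    by (rule strong_law_bounded[OF i gmeas gbound])
  then have "AE \<omega> in M. (\<lambda>n. ((\<Sum>k<n. of_bool (J k \<omega> = i) * \<rho> (J (Suc k) \<omega>)) - c * entries i \<omega> n) / real n) \<longlonglongrightarrow> 0"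
    using AE_space
  proof eventually_elim
    case (elim \<omega>)
    define \<Psi> where "\<Psi> = (\<lambda>k. of_bool (J k \<omega> = i) * T (age k \<omega>) (recent k \<omega>))"
    have \<Psi>: "\<bar>\<Psi> k\<bar> \<le> K" for k
      using T0[of "age k \<omega>" "recent k \<omega>"] TK[of "age k \<omega>" "recent k \<omega>"] by (auto simp: \<Psi>_def)
    \<comment> \<open>In regime \<open>i\<close> the Poisson equation identifies the conditional
      mean with \<open>\<Psi> k\<close>. Outside \<open>i\<close>, \<open>\<Psi>\<close> can only
      jump from 0 to \<open>c\<close>, exactly at an entry, which the entry term cancels.\<close>
    have step: "indicator {i} (J k \<omega>) * (g k \<omega> (\<xi> k \<omega>) - (\<integral>x. g k \<omega> x \<partial>P i))
        = of_bool (J k \<omega> = i) * \<rho> (J (Suc k) \<omega>) - c * of_bool (J k \<omega> \<noteq> i \<and> J (Suc k) \<omega> = i)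
          + (\<Psi> (Suc k) - \<Psi> k)" for k
    proof (cases "J k \<omega> = i")
      case True
      have "g k \<omega> (\<xi> k \<omega>) = \<rho> (J (Suc k) \<omega>) + \<Psi> (Suc k)"
        using J_Suc[OF elim(2), of k] True
        by (auto simp: g_def Gdef recent_Suc[symmetric] \<Psi>_def)
      moreover have "(\<integral>x. g k \<omega> x \<partial>P i) = \<Psi> k"
        using True by (simp add: g_def Teq[symmetric] \<Psi>_def)
      ultimately show ?thesis using True by simp
    next
      case False
      then show ?thesis by (auto simp: \<Psi>_def Tc)
    qed
    have "(\<Sum>k<n. indicator {i} (J k \<omega>) * (g k \<omega> (\<xi> k \<omega>) - (\<integral>x. g k \<omega> x \<partial>P i)))
        = ((\<Sum>k<n. of_bool (J k \<omega> = i) * \<rho> (J (Suc k) \<omega>)) - c * entries i \<omega> n) + (\<Psi> n - \<Psi> 0)" for n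
      unfolding step sum_lessThan_telescope[of \<Psi> n, symmetric] entries_def sum_distrib_left
        sum_subtractf[symmetric] sum.distrib[symmetric] ..
    then have eq: "((\<Sum>k<n. of_bool (J k \<omega> = i) * \<rho> (J (Suc k) \<omega>)) - c * entries i \<omega> n) / real n
      = (\<Sum>k<n. indicator {i} (J k \<omega>) * (g k \<omega> (\<xi> k \<omega>) - (\<integral>x. g k \<omega> x \<partial>P i))) / real n
        - (\<Psi> n - \<Psi> 0) / real n" for n
      by (simp add: add_divide_distrib)
    have "(\<lambda>n. (\<Psi> n - \<Psi> 0) / real n) \<longlonglongrightarrow> 0"
    proof (rule Lim_null_comparison)
      show "\<forall>\<^sub>F n in sequentially. norm ((\<Psi> n - \<Psi> 0) / real n) \<le> 2 * K / real n"
      proof (rule always_eventually, rule allI)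
        fix n
        have "\<bar>\<Psi> n - \<Psi> 0\<bar> \<le> 2 * K" using \<Psi>[of n] \<Psi>[of 0] by linarith
        then show "norm ((\<Psi> n - \<Psi> 0) / real n) \<le> 2 * K / real n" by (simp add: divide_right_mono)
      qed
      show "(\<lambda>n. 2 * K / real n) \<longlonglongrightarrow> 0" by (rule lim_const_over_n)
    qed
    from tendsto_diff[OF elim(1) this] show ?case unfolding eq by simp
  qed
  with \<open>c > 0\<close> show ?thesis unfolding reward_rate_def by blast
qed

text \<open>Steps have size at most 1, so the indicator of \<open>i < J k \<omega>\<close> changes
  exactly at crossings between \<open>i\<close> and \<open>Suc i\<close>; its increments
  telescope.\<close>

lemma crossings_balance:
  assumes \<omega>: "\<omega> \<in> space M"
  shows "(\<Sum>k<n. of_bool (J k \<omega> = i) * of_bool (J (Suc k) \<omega> = Suc i))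
     - (\<Sum>k<n. of_bool (J k \<omega> = Suc i) * of_bool (J (Suc k) \<omega> = i))
     = (of_bool (i < J n \<omega>) - of_bool (i < J 0 \<omega>) :: real)"
proof (induction n)
  case (Suc n)
  have "of_bool (J n \<omega> = i) * of_bool (J (Suc n) \<omega> = Suc i) - of_bool (J n \<omega> = Suc i) * of_bool (J (Suc n) \<omega> = i)
     = (of_bool (i < J (Suc n) \<omega>) - of_bool (i < J n \<omega>) :: real)"
    using J_Suc_cases[OF \<omega>, of n] by (cases "J n \<omega>"; cases "i < J n \<omega>") (auto simp: of_bool_def)
  with Suc show ?case unfolding sum.lessThan_Suc by linarith
qed simp

section \<open>The speed as a weighted mean\<close>

lemma X_eq_sum: "\<omega> \<in> space M \<Longrightarrow> X n \<omega> = (\<Sum>k<n. \<xi> k \<omega>)"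
  using X_0 by (simp add: sum_lessThan_telescope[of "\<lambda>k. X k \<omega>"])

theorem speed_exists: "\<exists>s::real. AE \<omega> in M. (\<lambda>n. X n \<omega> / real n) \<longlonglongrightarrow> s"
proof -
  \<comment> \<open>Reward 1 at every jump measures time, so \<open>m i\<close> plays the role of
    the mean stay; the two rewards below single out one direction of exit each.\<close>
  have "\<exists>c>0. reward_rate i (\<lambda>_. 1) c" if "i \<le> l" for i
  proof (rule rewards_proportional_to_entries[OF that])
    have "space (P i) = UNIV" using sets_eq_imp_space_eq[OF P_sets[OF that]] by simp
    then show "measure (P i) UNIV > 0" using prob_space.prob_space[OF P_prob[OF that]] by simp
  qed auto
  then obtain m where m: "\<And>i. i \<le> l \<Longrightarrow> m i > 0" "\<And>i. i \<le> l \<Longrightarrow> reward_rate i (\<lambda>_. 1) (m i)"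
    by metis
  have "\<exists>c>0. reward_rate i (\<lambda>k. of_bool (k = Suc i)) c" if "i < l" for i
    by (rule rewards_proportional_to_entries[where S = "up i"])
      (use that in \<open>auto simp: up_pos nxt_up up_down_borel\<close>)
  then obtain u where u: "\<And>i. i < l \<Longrightarrow> u i > 0"
      "\<And>i. i < l \<Longrightarrow> reward_rate i (\<lambda>k. of_bool (k = Suc i)) (u i)"
    by metis
  have "\<exists>c>0. reward_rate (Suc i) (\<lambda>k. of_bool (k = i)) c" if "i < l" for i
    by (rule rewards_proportional_to_entries[where S = "down (Suc i)"])
      (use that in \<open>auto simp: down_pos nxt_down up_down_borel\<close>)
  then obtain d' where d': "\<And>i. i < l \<Longrightarrow> d' i > 0"
      "\<And>i. i < l \<Longrightarrow> reward_rate (Suc i) (\<lambda>k. of_bool (k = i)) (d' i)"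
    by metis
  define d where "d i = d' (i - 1)" for i
  \<comment> \<open>The limiting frequencies do not involve \<open>\<omega>\<close>; this is why the
    speed is almost surely constant.\<close>
  define p where "p = (\<lambda>i. m i * (\<Prod>j<i. u j / d (Suc j)) / (\<Sum>i\<le>l. m i * (\<Prod>j<i. u j / d (Suc j))))"
  have "AE \<omega> in M. \<forall>i\<in>{..l}. (\<lambda>n. ((\<Sum>k<n. of_bool (J k \<omega> = i)) - m i * entries i \<omega> n) / real n) \<longlonglongrightarrow> 0"
    using m(2) by (intro AE_finite_allI) (auto simp: reward_rate_def)
  moreover have "AE \<omega> in M. \<forall>i\<in>{..<l}. (\<lambda>n. ((\<Sum>k<n. of_bool (J k \<omega> = i) * of_bool (J (Suc k) \<omega> = Suc i)) - u i * entries i \<omega> n) / real n) \<longlonglongrightarrow> 0"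
    using u(2) by (intro AE_finite_allI) (auto simp: reward_rate_def)
  moreover have "AE \<omega> in M. \<forall>i\<in>{..<l}. (\<lambda>n. ((\<Sum>k<n. of_bool (J k \<omega> = Suc i) * of_bool (J (Suc k) \<omega> = i)) - d (Suc i) * entries (Suc i) \<omega> n) / real n) \<longlonglongrightarrow> 0"
    using d'(2) by (intro AE_finite_allI) (auto simp: reward_rate_def d_def)
  moreover have "AE \<omega> in M. \<forall>i\<in>{..l}. (\<lambda>n. (\<Sum>k<n. indicator {i} (J k \<omega>) * (\<xi> k \<omega> - mean (P i))) / real n) \<longlonglongrightarrow> 0"
    using strong_law_regime by (intro AE_finite_allI) auto
  moreover note AE_space
  ultimately have "AE \<omega> in M. (\<lambda>n. X n \<omega> / real n) \<longlonglongrightarrow> (\<Sum>i\<le>l. mean (P i) * p i)"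
  proof eventually_elim
    case (elim \<omega>)
    define a where "a = (\<lambda>i n. (\<Sum>k<n. of_bool (J k \<omega> = i)) / real n)"
    define e where "e = (\<lambda>i n. entries i \<omega> n / real n)"
    have one: "(\<Sum>i\<le>l. of_bool (J k \<omega> = i)) = (1::real)" for k
      using J_le[OF elim(5), of k] by (simp add: of_bool_def)
    have lim_a: "a i \<longlonglongrightarrow> p i" if "i \<le> l" for i
      unfolding p_def
    proof (rule balance_limits[of l a m e u d])
      show "(\<lambda>n. a i n - m i * e i n) \<longlonglongrightarrow> 0" if "i \<le> l" for i
        using elim(1) that by (auto simp: a_def e_def diff_divide_distrib)
      show "(\<lambda>n. u i * e i n - d (Suc i) * e (Suc i) n) \<longlonglongrightarrow> 0" if "i < l" for i
      proof -
        define U where "U = (\<lambda>n. \<Sum>k<n. of_bool (J k \<omega> = i) * of_bool (J (Suc k) \<omega> = Suc i) :: real)"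
        define D where "D = (\<lambda>n. \<Sum>k<n. of_bool (J k \<omega> = Suc i) * of_bool (J (Suc k) \<omega> = i) :: real)"
        have "(\<lambda>n. (U n - D n) / real n) \<longlonglongrightarrow> 0"
        proof (rule Lim_null_comparison)
          have "\<bar>U n - D n\<bar> \<le> 1" for n
            unfolding U_def D_def crossings_balance[OF elim(5)] by simp
          then show "\<forall>\<^sub>F n in sequentially. norm ((U n - D n) / real n) \<le> 1 / real n"
            by (intro always_eventually allI) (simp add: divide_right_mono)
          show "(\<lambda>n. 1 / real n) \<longlonglongrightarrow> 0" by (rule lim_const_over_n)
        qed
        moreover have "(\<lambda>n. (U n - u i * entries i \<omega> n) / real n) \<longlonglongrightarrow> 0"
          "(\<lambda>n. (D n - d (Suc i) * entries (Suc i) \<omega> n) / real n) \<longlonglongrightarrow> 0"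
          using elim(2,3) that by (auto simp: U_def D_def)
        \<comment> \<open>Combining the bounded discrepancy with the two rates eliminates the
          crossing counts and leaves the balance of entries.\<close>
        ultimately have "(\<lambda>n. (U n - D n) / real n - (U n - u i * entries i \<omega> n) / real n
            + (D n - d (Suc i) * entries (Suc i) \<omega> n) / real n) \<longlonglongrightarrow> 0 - 0 + 0"
          by (intro tendsto_intros)
        then show ?thesis by (simp add: e_def diff_divide_distrib)
      qed
      have "(\<Sum>i\<le>l. a i n) = 1" if "n \<ge> 1" for n
      proof -
        have "(\<Sum>i\<le>l. a i n) = (\<Sum>k<n. \<Sum>i\<le>l. of_bool (J k \<omega> = i)) / real n"
          unfolding a_def sum_divide_distrib[symmetric] by (subst sum.swap) (rule refl)
        also have "\<dots> = 1" unfolding one using that by simp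
        finally show ?thesis .
      qed
      then have "\<forall>\<^sub>F n in sequentially. (\<Sum>i\<le>l. a i n) = 1"
        by (rule eventually_sequentiallyI)
      then show "(\<lambda>n. \<Sum>i\<le>l. a i n) \<longlonglongrightarrow> 1" by (rule tendsto_eventually)
      show "m i > 0" if "i \<le> l" for i by (rule m(1)[OF that])
      show "u i > 0" if "i < l" for i by (rule u(1)[OF that])
      show "d (Suc i) > 0" if "i < l" for i unfolding d_def diff_Suc_1 by (rule d'(1)[OF that])
    qed (rule that)
    \<comment> \<open>Each jump is attributed to its regime and centred there: the centred part
      vanishes by the strong law, and the rest weights the means by occupation frequencies.\<close>
    have "X n \<omega> / real n = (\<Sum>i\<le>l. (\<Sum>k<n. indicator {i} (J k \<omega>) * (\<xi> k \<omega> - mean (P i))) / real n)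
        + (\<Sum>i\<le>l. mean (P i) * a i n)" for n
    proof -
      have "X n \<omega> = (\<Sum>k<n. (\<Sum>i\<le>l. of_bool (J k \<omega> = i)) * \<xi> k \<omega>)"
        unfolding one mult_1 by (rule X_eq_sum[OF elim(5)])
      also have "\<dots> = (\<Sum>i\<le>l. \<Sum>k<n. of_bool (J k \<omega> = i) * \<xi> k \<omega>)"
        unfolding sum_distrib_right by (rule sum.swap)
      also have "\<dots> = (\<Sum>i\<le>l. (\<Sum>k<n. indicator {i} (J k \<omega>) * (\<xi> k \<omega> - mean (P i)))
          + mean (P i) * (\<Sum>k<n. of_bool (J k \<omega> = i)))"
        unfolding sum_distrib_left sum.distrib[symmetric]
        by (intro sum.cong refl) (simp add: indicator_def algebra_simps)
      finally show ?thesis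
        by (simp add: sum.distrib add_divide_distrib sum_divide_distrib a_def)
    qed
    moreover have "(\<lambda>n. (\<Sum>i\<le>l. (\<Sum>k<n. indicator {i} (J k \<omega>) * (\<xi> k \<omega> - mean (P i))) / real n)
        + (\<Sum>i\<le>l. mean (P i) * a i n)) \<longlonglongrightarrow> (\<Sum>i\<le>l. 0) + (\<Sum>i\<le>l. mean (P i) * p i)"
      using elim(4) by (intro tendsto_intros lim_a) auto
    ultimately show ?case by simp
  qed
  then show ?thesis by blast
qed

end

theorem proposition1:
  fixes N l start :: nat
    and P :: "nat \<Rightarrow> real measure"
    and r :: "nat \<Rightarrow> real"
    and M :: "'a measure"
    and X :: "nat \<Rightarrow> 'a \<Rightarrow> real"
    and J :: "nat \<Rightarrow> 'a \<Rightarrow> nat"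
  assumes "l \<le> N"
    and "increment_distributions l P"
    and "assumption_A l P r"
    and "assumption_B l P r"
    and "delayed_process M N l P r start X J"
  shows "\<exists>s::real. AE \<omega> in M. (\<lambda>n. X n \<omega> / real n) \<longlonglongrightarrow> s"
proof -
  interpret delayed_process M N l P r start X J by fact
  interpret regime_walk_AB M N l P r start X J
    using assms(1-4) by unfold_locales
  show ?thesis by (rule speed_exists)
qed

end
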